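(* Let the contour $]0,1[\ni s\mapsto\tau(s)$, denoted $\gamma$, satisfy $$(z_1-\tau^{-1}z_{-2})^{\alpha+\nu}(z_2+\tau^{-1}z_{-1})^{\beta+\nu}\tau^{\nu-1}\Big|_{\tau(0)}^{\tau(1)}=0.$$ Then the function $$K_{\alpha,\beta,\mu,\nu}(z_{-1},z_1,z_{-2},z_2,z_{-3},z_3):=\int_\gamma(z_1-\tau^{-1}z_{-2})^{\alpha+\nu}(z_2+\tau^{-1}z_{-1})^{\beta+\nu}z_3^{\mu}\,\tau^{\nu-1}\frac{d\tau}{2\pi i}$$ is harmonic, i.e. $(2\partial_{z_{-1}}\partial_{z_1}+2\partial_{z_{-2}}\partial_{z_2}+2\partial_{z_{-3}}\partial_{z_3})K_{\alpha,\beta,\mu,\nu}=0$, and $$N_1K_{\alpha,\beta,\mu,\nu}=\alpha K_{\alpha,\beta,\mu,\nu},\qquad N_2K_{\alpha,\beta,\mu,\nu}=\beta K_{\alpha,\beta,\mu,\nu},\qquad N_3K_{\alpha,\beta,\mu,\nu}=\mu K_{\alpha,\beta,\mu,\nu}.$$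
   Context: $\alpha,\beta,\mu,\nu$ are complex parameters. $\mathbb R^6$ has coordinates $z_{-1},z_1,z_{-2},z_2,z_{-3},z_3$ and scalar product $\langle z|z\rangle=2z_{-1}z_1+2z_{-2}z_2+2z_{-3}z_3$ (formulas are understood to be continued analytically to appropriate complex domains). $N_j:=-z_{-j}\partial_{z_{-j}}+z_j\partial_{z_j}$ for $j=1,2,3$. $G(\tau)\big|_{\tau(0)}^{\tau(1)}$ denotes the difference of the values of $G$ at the two ends of the contour.
   Formalization: If α+ν=β+ν=0, it is also assumed that τ^ν has equal values at the two ends (the claim fails for α=β=−1, ν=1, μ=0, τ(s)=1+s); the implicit convergence of the integral is taken to be locally uniform in z. *)

theory Defs
  imports "HOL-Complex_Analysis.Complex_Analysis"
begin

text \<open>\<open>Zm\<close>$j$ and \<open>Zp\<close>$j$ index the coordinates $z_{-j}$ and $z_j$; points of the (complexified)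
  six-dimensional space are vectors of type \<open>complex ^ coord\<close>.\<close>

datatype coord = Zm1 | Zp1 | Zm2 | Zp2 | Zm3 | Zp3

instance coord :: finite
proof
  have "(UNIV :: coord set) = {Zm1, Zp1, Zm2, Zp2, Zm3, Zp3}"
    using coord.exhaust by blast
  then show "finite (UNIV :: coord set)"
    by (metis finite.emptyI finite.insertI)
qed

definition pd :: "coord \<Rightarrow> (complex ^ coord \<Rightarrow> complex) \<Rightarrow> complex ^ coord \<Rightarrow> complex" where
  "pd i f z = deriv (\<lambda>t. f (z + axis i t)) 0"

text \<open>\<^const>\<open>deriv\<close> is a total function, so identities between partial derivatives only carry
  meaning together with the existence of these derivatives.\<close>

definition has_pds_on :: "(complex ^ coord \<Rightarrow> complex) \<Rightarrow> (complex ^ coord) set \<Rightarrow> bool" where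
  "has_pds_on f \<Omega> \<longleftrightarrow>
     (\<forall>z\<in>\<Omega>. \<forall>i. (\<lambda>t. f (z + axis i t)) field_differentiable (at 0))"

definition laplacian :: "(complex ^ coord \<Rightarrow> complex) \<Rightarrow> complex ^ coord \<Rightarrow> complex" where
  "laplacian f z = 2 * pd Zm1 (pd Zp1 f) z + 2 * pd Zm2 (pd Zp2 f) z + 2 * pd Zm3 (pd Zp3 f) z"

definition N1 :: "(complex ^ coord \<Rightarrow> complex) \<Rightarrow> complex ^ coord \<Rightarrow> complex" where
  "N1 f z = - z $ Zm1 * pd Zm1 f z + z $ Zp1 * pd Zp1 f z"

definition N2 :: "(complex ^ coord \<Rightarrow> complex) \<Rightarrow> complex ^ coord \<Rightarrow> complex" where
  "N2 f z = - z $ Zm2 * pd Zm2 f z + z $ Zp2 * pd Zp2 f z"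

definition N3 :: "(complex ^ coord \<Rightarrow> complex) \<Rightarrow> complex ^ coord \<Rightarrow> complex" where
  "N3 f z = - z $ Zm3 * pd Zm3 f z + z $ Zp3 * pd Zp3 f z"

text \<open>Complex powers are multivalued.  They are continued along the contour by means of a continuous
  branch \<open>L\<close> of the logarithm of the base \<open>f\<close>; the power of exponent \<open>a\<close> is then
  $\exp (a L)$.  In particular a contour may wind around a branch point.\<close>

definition log_branch ::
  "'a::topological_space set \<Rightarrow> ('a \<Rightarrow> complex) \<Rightarrow> ('a \<Rightarrow> complex) \<Rightarrow> bool" where
  "log_branch S f L \<longleftrightarrow> continuous_on S L \<and> (\<forall>x\<in>S. exp (L x) = f x)"

definition branch_power :: "('a \<Rightarrow> complex) \<Rightarrow> complex \<Rightarrow> 'a \<Rightarrow> complex" where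
  "branch_power L a x = exp (a * L x)"

text \<open>A contour is parametrized by the open unit interval.  It is piecewise $C^1$ on compact
  subintervals, and nothing is required at its ends: they may be singular points of the integrand, or
  infinity.\<close>

definition open_contour :: "(real \<Rightarrow> complex) \<Rightarrow> bool" where
  "open_contour \<tau> \<longleftrightarrow>
     (\<forall>a b. 0 < a \<and> a < b \<and> b < 1 \<longrightarrow> \<tau> piecewise_C1_differentiable_on {a..b})"

definition has_end_difference :: "(real \<Rightarrow> complex) \<Rightarrow> complex \<Rightarrow> bool" where
  "has_end_difference G d \<longleftrightarrow>
     (\<exists>g0 g1. (G \<longlongrightarrow> g0) (at_right 0) \<and> (G \<longlongrightarrow> g1) (at_left 1) \<and> g1 - g0 = d)"

text \<open>If $\alpha + \nu = \beta + \nu = 0$, the boundary function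
  $(z_1 - \tau^{-1} z_{-2})^{\alpha+\nu} (z_2 + \tau^{-1} z_{-1})^{\beta+\nu} \tau^{\nu-1}$ does not depend
  on $z$, and the equality of its values at the two ends does not imply the eigenvalue equations: for
  $\alpha = \beta = -1$, $\nu = 1$ it is identically $1$, while the integral is $z_3^\mu$ times the
  difference of the end points of the contour, divided by $2 \pi i$.  In this case the theorem
  requires in addition that $\tau^\nu$ takes equal values at the two ends.\<close>

text \<open>Here \<open>logA\<close>, \<open>logB\<close>, \<open>logT\<close>, \<open>logZ\<close> are branches of the logarithms of $z_1 - \tau^{-1} z_{-2}$,
  $z_2 + \tau^{-1} z_{-1}$, $\tau$ and $z_3$, respectively.\<close>

definition integrand ::
  "(real \<times> (complex ^ coord) \<Rightarrow> complex) \<Rightarrow> (real \<times> (complex ^ coord) \<Rightarrow> complex) \<Rightarrow>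
   (real \<Rightarrow> complex) \<Rightarrow> (complex ^ coord \<Rightarrow> complex) \<Rightarrow> (real \<Rightarrow> complex) \<Rightarrow>
   complex \<Rightarrow> complex \<Rightarrow> complex \<Rightarrow> complex \<Rightarrow> complex ^ coord \<Rightarrow> real \<Rightarrow> complex" where
  "integrand logA logB logT logZ \<tau> \<alpha> \<beta> \<mu> \<nu> z s =
     branch_power logA (\<alpha> + \<nu>) (s, z) * branch_power logB (\<beta> + \<nu>) (s, z) *
     branch_power logZ \<mu> z * branch_power logT (\<nu> - 1) s *
     vector_derivative \<tau> (at s) / (2 * of_real pi * \<i>)"

text \<open>The Henstock--Kurzweil integral over the open unit interval includes improper integrals.\<close>

definition K ::
  "(real \<times> (complex ^ coord) \<Rightarrow> complex) \<Rightarrow> (real \<times> (complex ^ coord) \<Rightarrow> complex) \<Rightarrow>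
   (real \<Rightarrow> complex) \<Rightarrow> (complex ^ coord \<Rightarrow> complex) \<Rightarrow> (real \<Rightarrow> complex) \<Rightarrow>
   complex \<Rightarrow> complex \<Rightarrow> complex \<Rightarrow> complex \<Rightarrow> complex ^ coord \<Rightarrow> complex" where
  "K logA logB logT logZ \<tau> \<alpha> \<beta> \<mu> \<nu> z =
     integral {0<..<1} (integrand logA logB logT logZ \<tau> \<alpha> \<beta> \<mu> \<nu> z)"

text \<open>Locally uniform convergence on \<open>\<Omega>\<close> of the improper integral over the open unit interval, the two
  ends being approached independently.\<close>

definition converges_locally_uniformly_on ::
  "(complex ^ coord \<Rightarrow> real \<Rightarrow> complex) \<Rightarrow> (complex ^ coord) set \<Rightarrow> bool" where
  "converges_locally_uniformly_on F \<Omega> \<longleftrightarrow>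
     (\<forall>z\<in>\<Omega>. \<exists>U. open U \<and> z \<in> U \<and> U \<subseteq> \<Omega> \<and>
        uniform_limit U (\<lambda>(a, b) w. integral {a..b} (F w)) (\<lambda>w. integral {0<..<1} (F w))
          (at_right 0 \<times>\<^sub>F at_left 1))"

end

theory Submission
  imports Defs
begin

text \<open>
  Write \<open>p = \<alpha> + \<nu>\<close>, \<open>q = \<beta> + \<nu>\<close>, \<open>A = z\<^sub>1 - \<tau>\<inverse> z\<^sub>-\<^sub>2\<close>, \<open>B = z\<^sub>2 + \<tau>\<inverse> z\<^sub>-\<^sub>1\<close>.  The integrand is
  harmonic in \<open>z\<close>, and \<open>N\<^sub>1 - \<alpha>\<close> and \<open>N\<^sub>2 - \<beta>\<close> both turn it into the \<open>\<tau>\<close>-derivative of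
  \<open>A\<^sup>p B\<^sup>q z\<^sub>3\<^sup>\<mu> \<tau>\<^sup>\<nu>\<close>.  Derivatives pass through the improper integral because locally uniform limits of
  holomorphic functions may be differentiated termwise.  Thus everything follows once
  \<open>A\<^sup>p B\<^sup>q \<tau>\<^sup>\<nu>\<close> has equal limits \<open>g\<^sub>0, g\<^sub>1\<close> at the two ends; these limits exist because the integrals converge.

  The hypothesis, however, concerns \<open>A\<^sup>p B\<^sup>q \<tau>\<^sup>\<nu>\<^sup>-\<^sup>1\<close>, which has a common limit \<open>h\<close> at both ends.
  Suppose \<open>g\<^sub>0 \<noteq> g\<^sub>1\<close>.  If \<open>h = 0\<close>, then \<open>\<tau>\<close> runs into infinity at an end with nonzero \<open>g\<close>, and
  there the integral diverges logarithmically.  If \<open>h \<noteq> 0\<close>, then \<open>\<tau>\<close> has finite limits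
  \<open>\<tau>\<^sub>0 \<noteq> \<tau>\<^sub>1\<close> at the ends.  Computing the logarithmic derivative of \<open>h\<close> in the direction \<open>z\<^sub>1\<close> at
  either end gives \<open>p \<tau>\<^sub>i / (\<tau>\<^sub>i z\<^sub>1 - z\<^sub>-\<^sub>2)\<close> for \<open>i = 0, 1\<close>, whence \<open>p = 0\<close>; likewise \<open>q = 0\<close>.  That case
  is covered by the extra hypothesis on \<open>\<tau>\<^sup>\<nu>\<close>.
\<close>

section \<open>Partial derivatives, logarithms and limits\<close>

lemma axis_component: "(axis i t :: complex ^ coord) $ j = (if j = i then t else 0)"
  by (simp add: axis_def)

lemma axis_add: "(axis i s :: complex ^ coord) + axis i t = axis i (s + t)"
  by (simp add: vec_eq_iff axis_component)

lemma axis_zero: "(axis i 0 :: complex ^ coord) = 0"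
  by (simp add: vec_eq_iff axis_component)

lemma norm_axis_complex: "norm (axis i t :: complex ^ coord) = norm t"
  by (metis inner_axis_axis norm_eq_sqrt_inner)

lemma continuous_on_axis [continuous_intros]:
  assumes "continuous_on S f"
  shows "continuous_on S (\<lambda>x. axis i (f x) :: complex ^ coord)"
proof -
  have "continuous_on S (\<lambda>x. (\<chi> j. if j = i then f x else 0) :: complex ^ coord)"
  proof (intro continuous_on_vec_lambda)
    show "continuous_on S (\<lambda>x. if j = i then f x else 0)" for j
      using assms by (cases "j = i") auto
  qed
  moreover have "axis i (f x) = ((\<chi> j. if j = i then f x else 0) :: complex ^ coord)" for x
    by (simp add: vec_eq_iff axis_component)
  ultimately show ?thesis
    by (simp only:)
qed

lemma tendsto_add_axis:
  "((\<lambda>t. z + axis i t :: complex ^ coord) \<longlongrightarrow> z) (nhds 0)"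
proof -
  have "continuous_on UNIV (\<lambda>t. z + axis i t :: complex ^ coord)"
    by (intro continuous_intros)
  then have "((\<lambda>t. z + axis i t :: complex ^ coord) \<longlongrightarrow> z + axis i 0) (nhds 0)"
    using tendsto_at_iff_tendsto_nhds[of "\<lambda>t. z + axis i t :: complex ^ coord" 0]
    by (simp add: continuous_on_eq_continuous_at continuous_at)
  then show ?thesis
    by (simp only: axis_zero add_0_right)
qed

lemma eventually_add_axis_mem:
  assumes "open S" "z \<in> S"
  shows "\<forall>\<^sub>F t in nhds 0. (z + axis i t :: complex ^ coord) \<in> S"
  using tendsto_add_axis assms by (rule topological_tendstoD)

text \<open>Near a limit point an arbitrary branch is the principal one up to a constant: once
  \<open>L x\<close> is within pi of \<open>l\<close>, the imaginary part of \<open>L x - l\<close>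
  lies in the strip where \<open>Ln\<close> inverts \<open>exp\<close>.\<close>

lemma log_eq_add_Ln:
  fixes L f :: "'a \<Rightarrow> complex"
  assumes "(L \<longlongrightarrow> l) F" and "\<forall>\<^sub>F x in F. exp (L x) = f x"
  shows "\<forall>\<^sub>F x in F. L x = l + Ln (f x / exp l)"
proof -
  have "\<forall>\<^sub>F x in F. dist (L x) l < pi"
    using assms(1) by (rule tendstoD) simp
  then show ?thesis
    using assms(2)
  proof eventually_elim
    case (elim x)
    have "\<bar>Im (L x - l)\<bar> < pi"
      using elim(1) abs_Im_le_cmod[of "L x - l"] by (simp add: dist_norm)
    then have "Ln (exp (L x - l)) = L x - l"
      by (intro Ln_exp) auto
    then show ?case
      using elim(2) by (simp add: exp_diff)
  qed
qed

text \<open>By continuity \<open>L y\<close> is locally \<open>L x\<close> plus the principal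
  logarithm of \<open>f y / f x\<close>, whose argument is near 1, where \<open>Ln\<close> has
  derivative 1. The general domain serves real paths as well as complex lines.\<close>

lemma log_has_derivative:
  fixes L f :: "'a::real_normed_vector \<Rightarrow> complex"
  assumes "isCont L x" and ev: "\<forall>\<^sub>F y in nhds x. exp (L y) = f y"
    and f': "(f has_derivative f') (at x)"
  shows "(L has_derivative (\<lambda>h. f' h / f x)) (at x)"
proof -
  have fx: "exp (L x) = f x"
    using ev by (rule eventually_nhds_x_imp_x)
  then have nz: "f x \<noteq> 0"
    by (metis exp_not_eq_zero)
  have "(L \<longlongrightarrow> L x) (nhds x)"
    using assms(1) by (simp add: isCont_def tendsto_at_iff_tendsto_nhds)
  from log_eq_add_Ln[OF this ev]
  have eq: "\<forall>\<^sub>F y in nhds x. L y = L x + Ln (f y / f x)"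
    by (simp add: fx)
  have "((\<lambda>y. f y / f x) has_derivative (\<lambda>h. f' h / f x)) (at x)"
    using bounded_linear.has_derivative[OF bounded_linear_divide f'] .
  moreover have "(Ln has_field_derivative 1) (at (f x / f x))"
    using nz has_field_derivative_Ln[of 1] by simp
  ultimately have "((\<lambda>y. Ln (f y / f x)) has_derivative (\<lambda>h. f' h / f x)) (at x)"
    using has_derivative_compose[of "\<lambda>y. f y / f x" "\<lambda>h. f' h / f x" x UNIV Ln "(*) 1"] nz
    by (simp add: has_field_derivative_def)
  then have "((\<lambda>y. L x + Ln (f y / f x)) has_derivative (\<lambda>h. f' h / f x)) (at x)"
    using has_derivative_add[OF has_derivative_const] by fastforce
  then show ?thesis
    by (rule has_derivative_transform_eventually)
      (use eq eventually_nhds_x_imp_x[OF eq] in \<open>auto simp: eventually_at_filter elim: eventually_mono\<close>)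
qed

text \<open>Moving the base point to \<open>z + axis i t\<close> turns the difference quotient at
  parameter \<open>t\<close> into one at parameter 0, where \<open>has_pds_on\<close>
  applies.\<close>

lemma has_pds_on_imp_holomorphic:
  assumes "has_pds_on f \<Omega>" "open S" "\<And>t. t \<in> S \<Longrightarrow> z + axis i t \<in> \<Omega>"
  shows "(\<lambda>t. f (z + axis i t)) holomorphic_on S"
proof -
  have "(\<lambda>t. f (z + axis i t)) field_differentiable (at t)" if "t \<in> S" for t
  proof -
    have "(\<lambda>u. f (z + axis i t + axis i u)) field_differentiable (at (t - t))"
      using assms that by (simp add: has_pds_on_def)
    moreover have "(\<lambda>u. u - t) field_differentiable (at t)"
      by (intro derivative_intros)
    ultimately have "((\<lambda>u. f (z + axis i t + axis i u)) \<circ> (\<lambda>u. u - t)) field_differentiable (at t)"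
      by (rule field_differentiable_compose[rotated])
    then show ?thesis
      by (simp add: o_def add.assoc axis_add)
  qed
  then show ?thesis
    using assms(2) by (simp add: holomorphic_on_def field_differentiable_at_within)
qed

lemma pd_eqI:
  assumes "((\<lambda>t. f (z + axis i t)) has_field_derivative d) (at 0)"
  shows "pd i f z = d"
  unfolding pd_def using assms by (rule DERIV_imp_deriv)

lemma pd_cong:
  assumes "open \<Omega>" "z \<in> \<Omega>" "\<And>w. w \<in> \<Omega> \<Longrightarrow> f w = g w"
  shows "pd i f z = pd i g z"
  unfolding pd_def
  by (intro deriv_cong_ev refl eventually_mono[OF eventually_add_axis_mem[OF assms(1,2)]]) (use assms(3) in auto)

lemma has_pds_on_cong:
  assumes "open \<Omega>" "\<And>w. w \<in> \<Omega> \<Longrightarrow> f w = g w" "has_pds_on g \<Omega>"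
  shows "has_pds_on f \<Omega>"
  unfolding has_pds_on_def
proof (intro ballI allI)
  fix z i assume z: "z \<in> \<Omega>"
  have ev: "\<forall>\<^sub>F t in nhds 0. f (z + axis i t) = g (z + axis i t)"
    by (rule eventually_mono[OF eventually_add_axis_mem[OF assms(1) z]]) (use assms(2) in auto)
  have "(\<lambda>t. g (z + axis i t)) field_differentiable at 0"
    using assms(3) z by (simp add: has_pds_on_def)
  then show "(\<lambda>t. f (z + axis i t)) field_differentiable at 0"
    unfolding field_differentiable_def using DERIV_cong_ev[OF refl ev refl] by blast
qed

section \<open>Locally uniform limits and termwise differentiation\<close>

definition loc_uniform_limit ::
  "(complex ^ coord) set \<Rightarrow> ('a \<Rightarrow> complex ^ coord \<Rightarrow> complex) \<Rightarrow> (complex ^ coord \<Rightarrow> complex) \<Rightarrow>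
   'a filter \<Rightarrow> bool" where
  "loc_uniform_limit \<Omega> f g F \<longleftrightarrow>
     (\<forall>z\<in>\<Omega>. \<exists>U. open U \<and> z \<in> U \<and> U \<subseteq> \<Omega> \<and> uniform_limit U f g F)"

lemma loc_uniform_limit_tendsto:
  assumes "loc_uniform_limit \<Omega> f g F" "z \<in> \<Omega>"
  shows "((\<lambda>n. f n z) \<longlongrightarrow> g z) F"
  using assms unfolding loc_uniform_limit_def by (blast intro: tendsto_uniform_limitI)

text \<open>On each complex line parallel to a coordinate axis this is Weierstrass' theorem; Cauchy's
  inequality makes the convergence of the derivatives uniform in the remaining coordinates.\<close>

lemma
  assumes lim: "loc_uniform_limit \<Omega> f g F" and F: "F \<noteq> bot"
    and pds: "\<forall>\<^sub>F n in F. has_pds_on (f n) \<Omega>"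
  shows loc_uniform_limit_has_pds_on: "has_pds_on g \<Omega>"
    and loc_uniform_limit_pd: "loc_uniform_limit \<Omega> (\<lambda>n. pd i (f n)) (pd i g) F"
proof -
  have *: "\<exists>e>0. ball z e \<subseteq> \<Omega> \<and>
    (\<forall>w\<in>ball z e. \<forall>i. (\<lambda>t. g (w + axis i t)) field_differentiable (at 0)) \<and>
    (\<forall>i. uniform_limit (ball z e) (\<lambda>n. pd i (f n)) (pd i g) F)" if z: "z \<in> \<Omega>" for z
  proof -
    obtain U where U: "open U" "z \<in> U" "U \<subseteq> \<Omega>" "uniform_limit U f g F"
      using lim z unfolding loc_uniform_limit_def by blast
    obtain e' where e': "e' > 0" "ball z e' \<subseteq> U"
      using U openE by blast
    \<comment> \<open>The centre will range over radius \<open>e\<close> and the line parameter over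
      radius \<open>2 * e\<close>, so that all points stay within \<open>3 * e\<close> of
      \<open>z\<close>.\<close>
    define e where "e = e' / 3"
    have e: "e > 0" "ball z (3 * e) \<subseteq> U"
      using e' by (auto simp: e_def)
    have mem: "w + axis i t \<in> U" if "w \<in> ball z e" "norm t < 2 * e" for w t i
    proof -
      have "dist z (w + axis i t) \<le> dist z w + norm (axis i t)"
        by (metis add_diff_cancel_left' dist_commute dist_norm dist_triangle2 dist_triangle)
      then show ?thesis
        using that e by (auto simp: norm_axis_complex)
    qed
    have hol: "\<forall>\<^sub>F n in F. \<forall>w\<in>ball z e. \<forall>i. (\<lambda>t. f n (w + axis i t)) holomorphic_on ball 0 (2 * e)"
      using pds
    proof eventually_elim
      case (elim n)
      show ?case
        by (intro ballI allI has_pds_on_imp_holomorphic[OF elim])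
          (use mem U(3) in \<open>auto simp: dist_norm\<close>)
    qed
    have cont: "continuous_on (cball 0 e) h" "h holomorphic_on ball 0 e"
      if "h holomorphic_on ball 0 (2 * e)" for h :: "complex \<Rightarrow> complex"
      using that e(1) by (auto intro!: holomorphic_on_imp_continuous_on intro: holomorphic_on_subset[OF that])
    have gl: "continuous_on (cball 0 e) (\<lambda>t. g (w + axis i t))"
        "(\<lambda>t. g (w + axis i t)) holomorphic_on ball 0 e" if w: "w \<in> ball z e" for w i
    proof -
      have "\<forall>\<^sub>F n in F. continuous_on (cball 0 e) (\<lambda>t. f n (w + axis i t)) \<and>
          (\<lambda>t. f n (w + axis i t)) holomorphic_on ball 0 e"
        using hol by eventually_elim (use cont w in blast)
      moreover have "uniform_limit (cball 0 e) (\<lambda>n t. f n (w + axis i t)) (\<lambda>t. g (w + axis i t)) F"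
      proof (rule uniform_limitI)
        fix \<epsilon> :: real assume "\<epsilon> > 0"
        from uniform_limitD[OF U(4) this]
        show "\<forall>\<^sub>F n in F. \<forall>t\<in>cball 0 e. dist (f n (w + axis i t)) (g (w + axis i t)) < \<epsilon>"
          by eventually_elim (use mem[OF w] e(1) in auto)
      qed
      ultimately have "continuous_on (cball 0 e) (\<lambda>t. g (w + axis i t)) \<and>
          (\<lambda>t. g (w + axis i t)) holomorphic_on ball 0 e"
        by (auto intro: holomorphic_uniform_limit[OF _ _ F])
      then show "continuous_on (cball 0 e) (\<lambda>t. g (w + axis i t))"
        "(\<lambda>t. g (w + axis i t)) holomorphic_on ball 0 e"
        by auto
    qed
    have diff: "(\<lambda>t. g (w + axis i t)) field_differentiable (at 0)" if "w \<in> ball z e" for w i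
      using gl(2)[OF that] e(1) by (intro holomorphic_on_imp_differentiable_at[of _ "ball 0 e"]) auto
    have "uniform_limit (ball z e) (\<lambda>n. pd i (f n)) (pd i g) F" for i
    proof (rule uniform_limitI)
      fix \<epsilon> :: real assume "\<epsilon> > 0"
      \<comment> \<open>Cauchy's inequality on the circle of radius \<open>e\<close> divides this
        bound by \<open>e\<close>, which leaves \<open>\<epsilon> / 2\<close> for the
        derivatives.\<close>
      then have "\<forall>\<^sub>F n in F. \<forall>w\<in>U. dist (f n w) (g w) < \<epsilon> * e / 2"
        using e(1) by (intro uniform_limitD[OF U(4)]) auto
      then show "\<forall>\<^sub>F n in F. \<forall>w\<in>ball z e. dist (pd i (f n) w) (pd i g w) < \<epsilon>"
        using hol
      proof eventually_elim
        case (elim n)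
        show ?case
        proof
          fix w assume w: "w \<in> ball z e"
          note fh = cont[OF elim(2)[rule_format, OF w, of i]]
          have "norm ((deriv ^^ 1) (\<lambda>t. f n (w + axis i t) - g (w + axis i t)) 0)
              \<le> fact 1 * (\<epsilon> * e / 2) / e ^ 1"
          proof (rule Cauchy_inequality)
            show "norm (f n (w + axis i t) - g (w + axis i t)) \<le> \<epsilon> * e / 2" if "norm (0 - t) = e" for t
              using elim(1) mem[OF w, of t i] that e(1) by (simp add: dist_norm less_imp_le)
          qed (use fh gl[OF w] e(1) in \<open>auto intro!: holomorphic_intros continuous_intros\<close>)
          moreover have "(\<lambda>t. f n (w + axis i t)) field_differentiable (at 0)"
            using fh(2) e(1) by (intro holomorphic_on_imp_differentiable_at[of _ "ball 0 e"]) auto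
          ultimately show "dist (pd i (f n) w) (pd i g w) < \<epsilon>"
            using diff[OF w, of i] e(1) \<open>\<epsilon> > 0\<close> by (simp add: pd_def dist_norm)
        qed
      qed
    qed
    then show ?thesis
      using e mem diff U(3) by (intro exI[of _ e]) fastforce+
  qed
  show "has_pds_on g \<Omega>"
    unfolding has_pds_on_def using * by (meson centre_in_ball)
  show "loc_uniform_limit \<Omega> (\<lambda>n. pd i (f n)) (pd i g) F"
    unfolding loc_uniform_limit_def using * by (meson centre_in_ball open_ball)
qed

text \<open>Comparing two differences with the same \<open>b\<close> cancels \<open>g b\<close>, so
  \<open>f\<close> is Cauchy along \<open>F\<close>; a common \<open>a\<close> does the same for
  \<open>g\<close>. Completeness then supplies the limits. This separates the two ends of the
  contour.\<close>

lemma tendsto_difference_prod_filter: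
  fixes f g :: "real \<Rightarrow> complex"
  assumes lim: "((\<lambda>(a, b). g b - f a) \<longlongrightarrow> m) (F \<times>\<^sub>F F')" and F: "F \<noteq> bot" "F' \<noteq> bot"
  obtains l l' where "(f \<longlongrightarrow> l) F" "(g \<longlongrightarrow> l') F'" "l' - l = m"
proof -
  have "\<exists>P P'. eventually P F \<and> eventually P' F' \<and> (\<forall>a b. P a \<and> P' b \<longrightarrow> dist (g b - f a) m < e / 2)"
    if "e > 0" for e
    using tendstoD[OF lim, of "e / 2"] that unfolding eventually_prod_filter by (auto simp: split_def)
  then have *: "\<exists>P P'. eventually P F \<and> eventually P' F' \<and>
      (\<forall>a b a' b'. P a \<and> P' b \<and> P a' \<and> P' b' \<longrightarrow> dist (g b - f a) (g b' - f a') < e)" if "e > 0" for e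
    using that by (meson dist_triangle_half_l)
  have cf: "cauchy_filter (filtermap f F)"
    unfolding cauchy_filter_metric_filtermap
  proof (intro allI impI)
    fix e :: real assume "e > 0"
    from *[OF this] obtain P P' where P: "eventually P F" "eventually P' F'"
      "\<And>a b a' b'. P a \<Longrightarrow> P' b \<Longrightarrow> P a' \<Longrightarrow> P' b' \<Longrightarrow> dist (g b - f a) (g b' - f a') < e" by blast
    obtain b where "P' b"
      using eventually_happens'[OF F(2) P(2)] by blast
    then have "\<And>x y. P x \<Longrightarrow> P y \<Longrightarrow> dist (f x) (f y) < e"
      using P(3)[of y b x b for x y] \<open>P' b\<close> by (simp add: dist_norm)
    then show "\<exists>P. eventually P F \<and> (\<forall>x y. P x \<and> P y \<longrightarrow> dist (f x) (f y) < e)"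
      using P(1) by blast
  qed
  have "\<exists>l. (f \<longlongrightarrow> l) F"
    using cauchy_filter_complete_converges[OF cf complete_UNIV] F(1)
    by (auto simp: filterlim_def filtermap_bot_iff)
  then obtain l where l: "(f \<longlongrightarrow> l) F" by blast
  have cg: "cauchy_filter (filtermap g F')"
    unfolding cauchy_filter_metric_filtermap
  proof (intro allI impI)
    fix e :: real assume "e > 0"
    from *[OF this] obtain P P' where P: "eventually P F" "eventually P' F'"
      "\<And>a b a' b'. P a \<Longrightarrow> P' b \<Longrightarrow> P a' \<Longrightarrow> P' b' \<Longrightarrow> dist (g b - f a) (g b' - f a') < e" by blast
    obtain a where "P a"
      using eventually_happens'[OF F(1) P(1)] by blast
    then have "\<And>x y. P' x \<Longrightarrow> P' y \<Longrightarrow> dist (g x) (g y) < e"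
      using P(3)[of a x a y for x y] \<open>P a\<close> by (simp add: dist_norm)
    then show "\<exists>P. eventually P F' \<and> (\<forall>x y. P x \<and> P y \<longrightarrow> dist (g x) (g y) < e)"
      using P(2) by blast
  qed
  have "\<exists>l'. (g \<longlongrightarrow> l') F'"
    using cauchy_filter_complete_converges[OF cg complete_UNIV] F(2)
    by (auto simp: filterlim_def filtermap_bot_iff)
  then obtain l' where l': "(g \<longlongrightarrow> l') F'" by blast
  have "((\<lambda>x. g (snd x) - f (fst x)) \<longlongrightarrow> l' - l) (F \<times>\<^sub>F F')"
    by (intro tendsto_diff filterlim_compose[OF l' filterlim_snd] filterlim_compose[OF l filterlim_fst])
  with lim have "l' - l = m"
    using F by (intro tendsto_unique[of "F \<times>\<^sub>F F'"]) (auto simp: split_def prod_filter_eq_bot)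
  with l l' show thesis by (rule that)
qed

section \<open>Continuous logarithms near an end of the parameter interval\<close>

definition is_end :: "real filter \<Rightarrow> bool" where
  "is_end F \<longleftrightarrow> F = at_right 0 \<or> F = at_left 1"

lemma is_end_nontrivial: "is_end F \<Longrightarrow> F \<noteq> bot"
  by (metis is_end_def trivial_limit_at_left_real trivial_limit_at_right_real)

text \<open>The point is that \<open>S\<close> is an interval: later, branches are compared and
  primitives are used on a connected one-sided neighbourhood of the end.\<close>

lemma is_end_interval:
  assumes "is_end F" "\<forall>\<^sub>F s in F. P s"
  obtains S where "is_interval S" "S \<subseteq> {0<..<1}" "\<forall>\<^sub>F s in F. s \<in> S" "\<And>s. s \<in> S \<Longrightarrow> P s"
  using assms(1) unfolding is_end_def
proof
  assume F: "F = at_right 0"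
  then obtain b where b: "b > 0" "\<And>s. 0 < s \<Longrightarrow> s < b \<Longrightarrow> P s"
    using assms(2) by (auto simp: eventually_at_right_field)
  show ?thesis
  proof (rule that[of "{0<..<min b 1}"])
    show "\<forall>\<^sub>F s in F. s \<in> {0<..<min b 1}"
      unfolding F using b(1) by (intro eventually_at_right_real) auto
  qed (use b in \<open>auto simp: is_interval_oo\<close>)
next
  assume F: "F = at_left 1"
  then obtain b where b: "b < 1" "\<And>s. b < s \<Longrightarrow> s < 1 \<Longrightarrow> P s"
    using assms(2) by (auto simp: eventually_at_left_field)
  show ?thesis
  proof (rule that[of "{max b 0<..<1}"])
    show "\<forall>\<^sub>F s in F. s \<in> {max b 0<..<1}"
      unfolding F using b(1) by (intro eventually_at_left_real) auto
  qed (use b in \<open>auto simp: is_interval_oo\<close>)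
qed

text \<open>The difference of the two logarithms takes values in 2 pi i Z, whose points are 2 pi
  apart; a continuous function with such a range is constant on a connected set.\<close>

lemma log_unique:
  fixes L M :: "'a::topological_space \<Rightarrow> complex"
  assumes S: "connected S" and L: "continuous_on S L" and M: "continuous_on S M"
    and eq: "\<And>x. x \<in> S \<Longrightarrow> exp (L x) = exp (M x)"
    and x0: "x0 \<in> S" "L x0 = M x0" and x: "x \<in> S"
  shows "L x = M x"
proof -
  have "(\<lambda>x. L x - M x) constant_on S"
  proof (rule continuous_discrete_range_constant[OF S])
    show "continuous_on S (\<lambda>x. L x - M x)"
      by (intro continuous_intros L M)
    fix x assume x: "x \<in> S"
    have "2 * pi \<le> norm (L y - M y - (L x - M x))" if y: "y \<in> S" and ne: "L y - M y \<noteq> L x - M x" for y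
    proof (rule ccontr)
      assume *: "\<not> ?thesis"
      have "L y - M y = L x - M x"
      proof (rule exp_complex_eqI)
        show "\<bar>Im (L y - M y) - Im (L x - M x)\<bar> < 2 * pi"
          using * abs_Im_le_cmod[of "L y - M y - (L x - M x)"] by auto
        show "exp (L y - M y) = exp (L x - M x)"
          using eq x y by (simp add: exp_diff)
      qed
      with ne show False by contradiction
    qed
    then show "\<exists>e>0. \<forall>y. y \<in> S \<and> L y - M y \<noteq> L x - M x \<longrightarrow> e \<le> norm (L y - M y - (L x - M x))"
      by (intro exI[of _ "2 * pi"]) auto
  qed
  then show ?thesis
    using x0 x unfolding constant_on_def by (metis eq_iff_diff_eq_0)
qed

text \<open>A nonzero limit of the exponential prevents further winding: near the end
  \<open>exp (L s) / c\<close> stays in the unit disc about 1, where \<open>Ln\<close> is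
  continuous, and uniqueness of logarithms identifies \<open>L\<close> with a shifted principal
  branch.\<close>

lemma log_converges_at_end:
  assumes F: "is_end F" and L: "continuous_on {0<..<1} L"
    and lim: "((\<lambda>s. exp (L s)) \<longlongrightarrow> c) F" and c: "c \<noteq> (0::complex)"
  obtains l where "(L \<longlongrightarrow> l) F" "exp l = c"
proof -
  have "((\<lambda>s. exp (L s) / c) \<longlongrightarrow> c / c) F"
    by (intro tendsto_intros lim c)
  then have "\<forall>\<^sub>F s in F. dist (exp (L s) / c) 1 < 1"
    using c by (intro tendstoD) auto
  from is_end_interval[OF F this] obtain S where S: "is_interval S" "S \<subseteq> {0<..<1}"
    "\<forall>\<^sub>F s in F. s \<in> S" "\<And>s. s \<in> S \<Longrightarrow> dist (exp (L s) / c) 1 < 1" by blast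
  have Re: "Re (exp (L s) / c) > 0" if "s \<in> S" for s
    using S(4)[OF that] abs_Re_le_cmod[of "exp (L s) / c - 1"] by (auto simp: dist_norm)
  obtain s0 where s0: "s0 \<in> S"
    using eventually_happens'[OF is_end_nontrivial[OF F] S(3)] by blast
  \<comment> \<open>The two constants make \<open>M\<close> agree with \<open>L\<close> at
    \<open>s0\<close> while keeping \<open>exp (M s) = exp (L s)\<close>.\<close>
  define M where "M s = L s0 + Ln (exp (L s) / c) - Ln (exp (L s0) / c)" for s
  have "continuous_on S M"
    unfolding M_def using Re L S(2) c
    by (intro continuous_intros) (auto intro: continuous_on_subset[OF L] simp: complex_nonpos_Reals_iff not_le)
  moreover have "exp (L s) = exp (M s)" for s
    using c by (simp add: M_def exp_add exp_diff)
  moreover have "connected S"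
    using S(1) is_interval_connected_1 by blast
  moreover have "L s0 = M s0"
    by (simp add: M_def)
  ultimately have "L s = M s" if "s \<in> S" for s
    using log_unique[OF _ continuous_on_subset[OF L S(2)]] s0 that by blast
  then have ev: "\<forall>\<^sub>F s in F. M s = L s"
    by (intro eventually_mono[OF S(3)]) simp
  have "(M \<longlongrightarrow> L s0 + Ln (c / c) - Ln (exp (L s0) / c)) F"
    unfolding M_def using c by (intro tendsto_intros lim) auto
  then have l: "(L \<longlongrightarrow> L s0 + Ln (c / c) - Ln (exp (L s0) / c)) F"
    using tendsto_cong[OF ev] by blast
  show thesis
  proof (rule that[OF l])
    show "exp (L s0 + Ln (c / c) - Ln (exp (L s0) / c)) = c"
      using c by (simp add: exp_diff)
  qed
qed

section \<open>Integrals over compact parts of the contour\<close>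

text \<open>The first argument is the value of the contour rather than its parameter, so that the
  bases also make sense on line segments leaving the contour.\<close>

definition baseA :: "complex \<Rightarrow> complex ^ coord \<Rightarrow> complex" where
  "baseA w z = z $ Zp1 - inverse w * z $ Zm2"

definition baseB :: "complex \<Rightarrow> complex ^ coord \<Rightarrow> complex" where
  "baseB w z = z $ Zp2 + inverse w * z $ Zm1"

text \<open>As \<open>baseA w\<close> and \<open>baseB w\<close> are linear in \<open>z\<close>,
  their derivatives along axis \<open>i\<close> are their values at \<open>axis i 1\<close>. Hence
  this is the partial derivative of p log A + q log B + m log z_3 in coordinate
  \<open>i\<close>.\<close>

definition log_deriv ::
  "complex \<Rightarrow> complex \<Rightarrow> complex \<Rightarrow> coord \<Rightarrow> complex \<Rightarrow> complex ^ coord \<Rightarrow> complex" where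
  "log_deriv p q m i w z =
     p * baseA w (axis i 1) / baseA w z + q * baseB w (axis i 1) / baseB w z +
     m * (axis i 1 :: complex ^ coord) $ Zp3 / z $ Zp3"

lemma baseA_add_axis: "baseA w (z + axis i t) = baseA w z + t * baseA w (axis i 1)"
  by (simp add: baseA_def axis_component algebra_simps)

lemma baseB_add_axis: "baseB w (z + axis i t) = baseB w z + t * baseB w (axis i 1)"
  by (simp add: baseB_def axis_component algebra_simps)

lemma continuous_on_baseA [continuous_intros]:
  "continuous_on S f \<Longrightarrow> continuous_on S g \<Longrightarrow> (\<And>x. x \<in> S \<Longrightarrow> f x \<noteq> 0) \<Longrightarrow>
   continuous_on S (\<lambda>x. baseA (f x) (g x))"
  unfolding baseA_def by (intro continuous_intros) auto

lemma continuous_on_baseB [continuous_intros]: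
  "continuous_on S f \<Longrightarrow> continuous_on S g \<Longrightarrow> (\<And>x. x \<in> S \<Longrightarrow> f x \<noteq> 0) \<Longrightarrow>
   continuous_on S (\<lambda>x. baseB (f x) (g x))"
  unfolding baseB_def by (intro continuous_intros) auto

lemma tendsto_baseA [tendsto_intros]:
  "(f \<longlongrightarrow> w) F \<Longrightarrow> (g \<longlongrightarrow> z) F \<Longrightarrow> w \<noteq> 0 \<Longrightarrow> ((\<lambda>x. baseA (f x) (g x)) \<longlongrightarrow> baseA w z) F"
  unfolding baseA_def by (intro tendsto_intros) auto

lemma tendsto_baseB [tendsto_intros]:
  "(f \<longlongrightarrow> w) F \<Longrightarrow> (g \<longlongrightarrow> z) F \<Longrightarrow> w \<noteq> 0 \<Longrightarrow> ((\<lambda>x. baseB (f x) (g x)) \<longlongrightarrow> baseB w z) F"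
  unfolding baseB_def by (intro tendsto_intros) auto

text \<open>Both integrals are the increment of one primitive of \<open>g\<close> from
  \<open>\<tau> c\<close> to \<open>\<tau> d\<close>. The fundamental theorem asks only for
  continuity and for differentiability off a finite set, so \<open>\<tau>'\<close> may be unbounded,
  whereas the integrand on the segment is continuous.\<close>

lemma has_integral_along_path:
  fixes g :: "complex \<Rightarrow> complex" and \<tau> :: "real \<Rightarrow> complex"
  assumes g: "g holomorphic_on ball w \<rho>" and "c \<le> d" and cont: "continuous_on {c..d} \<tau>"
    and ball: "\<And>s. s \<in> {c..d} \<Longrightarrow> \<tau> s \<in> ball w \<rho>"
    and S: "finite S" "\<And>s. s \<in> {c<..<d} - S \<Longrightarrow> (\<tau> has_vector_derivative \<tau>' s) (at s)"
  shows "((\<lambda>s. g (\<tau> s) * \<tau>' s) has_integral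
    integral {0..1} (\<lambda>x. g (linepath (\<tau> c) (\<tau> d) x) * (\<tau> d - \<tau> c))) {c..d}"
proof -
  obtain G where G: "\<And>x. x \<in> ball w \<rho> \<Longrightarrow> (G has_field_derivative g x) (at x)"
    using holomorphic_convex_primitive'[OF convex_ball open_ball g] by (metis at_within_open open_ball)
  have Gc: "continuous_on (ball w \<rho>) G"
    using G DERIV_isCont continuous_at_imp_continuous_on by blast
  have line: "linepath (\<tau> c) (\<tau> d) x \<in> ball w \<rho>" if "x \<in> {0..1}" for x
  proof -
    have "linepath (\<tau> c) (\<tau> d) x \<in> closed_segment (\<tau> c) (\<tau> d)"
      using that linepath_in_path by auto
    then show ?thesis
      using closed_segment_subset[OF ball ball convex_ball, of c d] \<open>c \<le> d\<close> by (meson atLeastAtMost_iff order_refl subsetD)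
  qed
  have "((\<lambda>s. g (\<tau> s) * \<tau>' s) has_integral G (\<tau> d) - G (\<tau> c)) {c..d}"
  proof (rule fundamental_theorem_of_calculus_interior_strong[OF S(1) \<open>c \<le> d\<close>])
    show "((\<lambda>s. G (\<tau> s)) has_vector_derivative g (\<tau> s) * \<tau>' s) (at s)" if "s \<in> {c<..<d} - S" for s
      using field_vector_diff_chain_at[OF S(2)[OF that] G[OF ball]] that by (simp add: o_def mult.commute)
    show "continuous_on {c..d} (\<lambda>s. G (\<tau> s))"
      using ball by (intro continuous_on_compose2[OF Gc cont]) auto
  qed
  moreover have "((\<lambda>x. g (linepath (\<tau> c) (\<tau> d) x) * (\<tau> d - \<tau> c)) has_integral
      G (linepath (\<tau> c) (\<tau> d) 1) - G (linepath (\<tau> c) (\<tau> d) 0)) {0..1}"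
  proof (rule fundamental_theorem_of_calculus)
    show "((\<lambda>x. G (linepath (\<tau> c) (\<tau> d) x)) has_vector_derivative
        g (linepath (\<tau> c) (\<tau> d) x) * (\<tau> d - \<tau> c)) (at x within {0..1})" if "x \<in> {0..1}" for x
      using field_vector_diff_chain_within[OF has_vector_derivative_linepath_within
          has_field_derivative_at_within[OF G[OF line[OF that]]]]
      by (simp add: o_def mult.commute)
  qed simp
  then have "integral {0..1} (\<lambda>x. g (linepath (\<tau> c) (\<tau> d) x) * (\<tau> d - \<tau> c)) = G (\<tau> d) - G (\<tau> c)"
    by (simp only: integral_unique linepath_1' linepath_0')
  ultimately show ?thesis
    by simp
qed

section \<open>The contour with its continuous branches\<close>

locale branched_contour =
  fixes \<Omega> :: "(complex ^ coord) set" and \<tau> :: "real \<Rightarrow> complex"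
    and logA logB :: "real \<times> (complex ^ coord) \<Rightarrow> complex"
    and logT :: "real \<Rightarrow> complex" and logZ :: "complex ^ coord \<Rightarrow> complex"
  assumes open_\<Omega>: "open \<Omega>"
    and contour: "open_contour \<tau>"
    and branchA: "log_branch ({0<..<1} \<times> \<Omega>) (\<lambda>(s, z). z $ Zp1 - inverse (\<tau> s) * z $ Zm2) logA"
    and branchB: "log_branch ({0<..<1} \<times> \<Omega>) (\<lambda>(s, z). z $ Zp2 + inverse (\<tau> s) * z $ Zm1) logB"
    and branchT: "log_branch {0<..<1} \<tau> logT"
    and branchZ: "log_branch \<Omega> (\<lambda>z. z $ Zp3) logZ"
begin

abbreviation \<tau>' :: "real \<Rightarrow> complex" where
  "\<tau>' s \<equiv> vector_derivative \<tau> (at s)"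

text \<open>Free exponents make this family stable under differentiation in \<open>z\<close>. The
  integrand of \<open>K\<close> is, up to the factor 1 / (2 pi i), the member with exponents
  \<alpha> + \<nu>, \<beta> + \<nu>, \<mu>, \<nu> - 1.\<close>

definition E :: "complex \<Rightarrow> complex \<Rightarrow> complex \<Rightarrow> complex \<Rightarrow> complex ^ coord \<Rightarrow> real \<Rightarrow> complex" where
  "E p q m r z s = exp (p * logA (s, z) + q * logB (s, z) + m * logZ z + r * logT s) * \<tau>' s"

lemma exp_logs:
  assumes "0 < s" "s < 1"
  shows "z \<in> \<Omega> \<Longrightarrow> exp (logA (s, z)) = baseA (\<tau> s) z"
    and "z \<in> \<Omega> \<Longrightarrow> exp (logB (s, z)) = baseB (\<tau> s) z"
    and "exp (logT s) = \<tau> s" and "\<tau> s \<noteq> 0"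
proof -
  show "exp (logA (s, z)) = baseA (\<tau> s) z" if "z \<in> \<Omega>"
    using branchA assms that unfolding log_branch_def baseA_def by fastforce
  show "exp (logB (s, z)) = baseB (\<tau> s) z" if "z \<in> \<Omega>"
    using branchB assms that unfolding log_branch_def baseB_def by fastforce
  show "exp (logT s) = \<tau> s"
    using branchT assms unfolding log_branch_def by auto
  then show "\<tau> s \<noteq> 0"
    by (metis exp_not_eq_zero)
qed

lemma exp_logZ: "z \<in> \<Omega> \<Longrightarrow> exp (logZ z) = z $ Zp3"
  using branchZ unfolding log_branch_def by auto

lemma bases_nonzero:
  assumes "0 < s" "s < 1" "z \<in> \<Omega>"
  shows "baseA (\<tau> s) z \<noteq> 0" "baseB (\<tau> s) z \<noteq> 0" "z $ Zp3 \<noteq> 0"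
  using exp_logs(1,2)[OF assms(1,2,3)] exp_logZ[OF assms(3)] by (metis exp_not_eq_zero)+

lemma continuous_on_logT: "continuous_on {0<..<1} logT"
  using branchT unfolding log_branch_def by auto

lemma continuous_on_logZ: "continuous_on \<Omega> logZ"
  using branchZ unfolding log_branch_def by auto

lemma continuous_on_logA: "continuous_on ({0<..<1} \<times> \<Omega>) logA"
  using branchA unfolding log_branch_def by auto

lemma continuous_on_logB: "continuous_on ({0<..<1} \<times> \<Omega>) logB"
  using branchB unfolding log_branch_def by auto

lemma continuous_on_logA1: "z \<in> \<Omega> \<Longrightarrow> continuous_on {0<..<1} (\<lambda>s. logA (s, z))"
  by (rule continuous_on_compose2[OF continuous_on_logA]) (auto intro!: continuous_intros)

lemma continuous_on_logB1: "z \<in> \<Omega> \<Longrightarrow> continuous_on {0<..<1} (\<lambda>s. logB (s, z))"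
  by (rule continuous_on_compose2[OF continuous_on_logB]) (auto intro!: continuous_intros)

lemma continuous_on_\<tau>: "continuous_on {0<..<1} \<tau>"
proof -
  have "continuous_on {0<..<1} (\<lambda>s. exp (logT s))"
    by (intro continuous_intros continuous_on_logT)
  then show ?thesis
    by (subst continuous_on_cong[OF refl]) (use exp_logs(3) in auto)
qed

lemma differentiable_off_finite:
  assumes "0 < a" "b < 1"
  obtains S where "finite S" "\<And>s. s \<in> {a<..<b} - S \<Longrightarrow> (\<tau> has_vector_derivative \<tau>' s) (at s)"
proof (cases "a < b")
  case True
  then have "\<tau> piecewise_C1_differentiable_on {a..b}"
    using contour assms by (simp add: open_contour_def)
  then obtain S where "finite S" "\<tau> C1_differentiable_on ({a..b} - S)"
    by (auto simp: piecewise_C1_differentiable_on_def)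
  then show thesis
    by (intro that[of S]) (auto simp: C1_differentiable_on_eq vector_derivative_works)
next
  case False
  then show thesis
    by (intro that[of "{}"]) auto
qed

text \<open>In this region the quotients by the values at \<open>w0\<close>, \<open>z0\<close> stay
  off the cut of \<open>Ln\<close>, so their principal logarithms are holomorphic in
  \<open>w\<close> and along lines in \<open>z\<close>.\<close>

definition nonpos_free :: "complex \<Rightarrow> complex ^ coord \<Rightarrow> complex \<Rightarrow> complex ^ coord \<Rightarrow> bool" where
  "nonpos_free w0 z0 w z \<longleftrightarrow> w \<noteq> 0 \<and> z \<in> \<Omega> \<and> w / w0 \<notin> \<real>\<^sub>\<le>\<^sub>0 \<and>
     baseA w z / baseA w0 z0 \<notin> \<real>\<^sub>\<le>\<^sub>0 \<and> baseB w z / baseB w0 z0 \<notin> \<real>\<^sub>\<le>\<^sub>0"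

text \<open>Near \<open>(s0, z0)\<close> the given branches become functions of
  \<open>\<tau> s\<close> and \<open>z\<close> instead of \<open>s\<close> and \<open>z\<close>,
  which exposes the holomorphic dependence of the integrand on the contour variable. Continuity at
  the base point fixes the additive constants, and all conditions are open.\<close>

lemma local_logs:
  assumes s0: "0 < s0" "s0 < 1" and z0: "z0 \<in> \<Omega>"
  obtains \<rho> \<epsilon> \<delta> where "\<rho> > 0" "\<epsilon> > 0" "\<delta> > 0"
    "\<And>w z. w \<in> ball (\<tau> s0) \<rho> \<Longrightarrow> z \<in> ball z0 \<epsilon> \<Longrightarrow> nonpos_free (\<tau> s0) z0 w z"
    "\<And>s. \<bar>s - s0\<bar> < \<delta> \<Longrightarrow> 0 < s \<and> s < 1 \<and> \<tau> s \<in> ball (\<tau> s0) \<rho>"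
    "\<And>s z. \<bar>s - s0\<bar> < \<delta> \<Longrightarrow> z \<in> ball z0 \<epsilon> \<Longrightarrow>
       logA (s, z) = logA (s0, z0) + Ln (baseA (\<tau> s) z / baseA (\<tau> s0) z0)"
    "\<And>s z. \<bar>s - s0\<bar> < \<delta> \<Longrightarrow> z \<in> ball z0 \<epsilon> \<Longrightarrow>
       logB (s, z) = logB (s0, z0) + Ln (baseB (\<tau> s) z / baseB (\<tau> s0) z0)"
    "\<And>s. \<bar>s - s0\<bar> < \<delta> \<Longrightarrow> logT s = logT s0 + Ln (\<tau> s / \<tau> s0)"
proof -
  let ?w = "\<tau> s0"
  have slit: "open (- \<real>\<^sub>\<le>\<^sub>0 :: complex set)" "(1::complex) \<in> - \<real>\<^sub>\<le>\<^sub>0"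
    using closed_nonpos_Reals_complex by (auto simp: open_closed)
  have w0: "?w \<noteq> 0" and nz: "baseA ?w z0 \<noteq> 0" "baseB ?w z0 \<noteq> 0"
    using exp_logs(4) bases_nonzero s0 z0 by blast+
  have lims: "(fst \<longlongrightarrow> ?w) (nhds ?w \<times>\<^sub>F nhds z0)" "(snd \<longlongrightarrow> z0) (nhds ?w \<times>\<^sub>F nhds z0)"
    by (rule filterlim_fst filterlim_snd)+
  have ev1: "\<forall>\<^sub>F x in nhds ?w \<times>\<^sub>F nhds z0. fst x \<noteq> 0"
    using lims(1) w0 by (rule tendsto_imp_eventually_ne)
  have ev2: "\<forall>\<^sub>F x in nhds ?w \<times>\<^sub>F nhds z0. snd x \<in> \<Omega>"
    using lims(2) open_\<Omega> z0 by (rule topological_tendstoD)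
  have slitI: "\<forall>\<^sub>F x in nhds ?w \<times>\<^sub>F nhds z0. f x \<in> - \<real>\<^sub>\<le>\<^sub>0"
    if "(f \<longlongrightarrow> 1) (nhds ?w \<times>\<^sub>F nhds z0)" for f :: "complex \<times> (complex ^ coord) \<Rightarrow> complex"
    using that slit by (rule topological_tendstoD)
  have ev3: "\<forall>\<^sub>F x in nhds ?w \<times>\<^sub>F nhds z0. fst x / ?w \<in> - \<real>\<^sub>\<le>\<^sub>0"
    by (rule slitI) (use tendsto_divide[OF lims(1) tendsto_const w0] w0 in simp)
  have ev4: "\<forall>\<^sub>F x in nhds ?w \<times>\<^sub>F nhds z0. baseA (fst x) (snd x) / baseA ?w z0 \<in> - \<real>\<^sub>\<le>\<^sub>0"
    by (rule slitI) (use tendsto_divide[OF tendsto_baseA[OF lims w0] tendsto_const nz(1)] nz in simp)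
  have ev5: "\<forall>\<^sub>F x in nhds ?w \<times>\<^sub>F nhds z0. baseB (fst x) (snd x) / baseB ?w z0 \<in> - \<real>\<^sub>\<le>\<^sub>0"
    by (rule slitI) (use tendsto_divide[OF tendsto_baseB[OF lims w0] tendsto_const nz(2)] nz in simp)
  have "\<forall>\<^sub>F x in nhds ?w \<times>\<^sub>F nhds z0. nonpos_free ?w z0 (fst x) (snd x)"
    using ev1 ev2 ev3 ev4 ev5 by eventually_elim (auto simp: nonpos_free_def)
  then obtain P Q where PQ: "eventually P (nhds ?w)" "eventually Q (nhds z0)"
      "\<And>w z. P w \<Longrightarrow> Q z \<Longrightarrow> nonpos_free ?w z0 w z"
    unfolding eventually_prod_filter by auto
  obtain \<rho> where \<rho>: "\<rho> > 0" "\<And>w. w \<in> ball ?w \<rho> \<Longrightarrow> P w"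
    using PQ(1) by (auto simp: eventually_nhds_metric dist_commute)
  obtain \<epsilon>1 where \<epsilon>1: "\<epsilon>1 > 0" "\<And>z. z \<in> ball z0 \<epsilon>1 \<Longrightarrow> Q z"
    using PQ(2) by (auto simp: eventually_nhds_metric dist_commute)
  have op: "open ({0<..<1::real} \<times> \<Omega>)" "(s0, z0) \<in> {0<..<1} \<times> \<Omega>"
    using s0 z0 open_\<Omega> by (auto intro: open_Times)
  have evm: "\<forall>\<^sub>F x in nhds (s0, z0). x \<in> {0<..<1} \<times> \<Omega>"
    using op by (rule eventually_nhds_in_open)
  have contA: "(logA \<longlongrightarrow> logA (s0, z0)) (nhds (s0, z0))"
    unfolding tendsto_at_iff_tendsto_nhds[symmetric] continuous_at[symmetric]
    using continuous_on_logA op continuous_on_eq_continuous_at by blast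
  have contB: "(logB \<longlongrightarrow> logB (s0, z0)) (nhds (s0, z0))"
    unfolding tendsto_at_iff_tendsto_nhds[symmetric] continuous_at[symmetric]
    using continuous_on_logB op continuous_on_eq_continuous_at by blast
  have "(\<tau> \<longlongrightarrow> ?w) (nhds s0)" "(logT \<longlongrightarrow> logT s0) (nhds s0)"
    unfolding tendsto_at_iff_tendsto_nhds[symmetric] continuous_at[symmetric]
    using continuous_on_\<tau> continuous_on_logT s0
    by (auto simp: continuous_on_eq_continuous_at)
  note contT = this
  have evm1: "\<forall>\<^sub>F s in nhds s0. s \<in> {0<..<1}"
    using s0 by (intro eventually_nhds_in_open) auto
  have evA: "\<forall>\<^sub>F x in nhds (s0, z0). logA x = logA (s0, z0) + Ln (baseA (\<tau> (fst x)) (snd x) / exp (logA (s0, z0)))"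
    using evm by (intro log_eq_add_Ln contA) (auto elim!: eventually_mono simp: exp_logs)
  have evB: "\<forall>\<^sub>F x in nhds (s0, z0). logB x = logB (s0, z0) + Ln (baseB (\<tau> (fst x)) (snd x) / exp (logB (s0, z0)))"
    using evm by (intro log_eq_add_Ln contB) (auto elim!: eventually_mono simp: exp_logs)
  have evT: "\<forall>\<^sub>F s in nhds s0. logT s = logT s0 + Ln (\<tau> s / exp (logT s0))"
    using evm1 by (intro log_eq_add_Ln contT) (auto elim!: eventually_mono simp: exp_logs)
  have evT': "\<forall>\<^sub>F s in nhds s0. \<tau> s \<in> ball ?w \<rho>"
    using \<rho>(1) by (intro topological_tendstoD[OF contT(1)]) auto
  have "\<forall>\<^sub>F x in nhds s0 \<times>\<^sub>F nhds z0.
      logA x = logA (s0, z0) + Ln (baseA (\<tau> (fst x)) (snd x) / exp (logA (s0, z0))) \<and>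
      logB x = logB (s0, z0) + Ln (baseB (\<tau> (fst x)) (snd x) / exp (logB (s0, z0)))"
    using evA evB unfolding nhds_prod by eventually_elim auto
  then obtain P' Q' where PQ': "eventually P' (nhds s0)" "eventually Q' (nhds z0)"
      "\<And>s z. P' s \<Longrightarrow> Q' z \<Longrightarrow>
        logA (s, z) = logA (s0, z0) + Ln (baseA (\<tau> s) z / exp (logA (s0, z0))) \<and>
        logB (s, z) = logB (s0, z0) + Ln (baseB (\<tau> s) z / exp (logB (s0, z0)))"
    unfolding eventually_prod_filter by auto
  have "\<forall>\<^sub>F s in nhds s0. P' s \<and> 0 < s \<and> s < 1 \<and> \<tau> s \<in> ball ?w \<rho> \<and>
      logT s = logT s0 + Ln (\<tau> s / exp (logT s0))"
    using PQ'(1) evm1 evT' evT by eventually_elim auto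
  then obtain \<delta> where \<delta>: "\<delta> > 0" "\<And>s. \<bar>s - s0\<bar> < \<delta> \<Longrightarrow> P' s \<and> 0 < s \<and> s < 1 \<and> \<tau> s \<in> ball ?w \<rho> \<and>
      logT s = logT s0 + Ln (\<tau> s / exp (logT s0))"
    unfolding eventually_nhds_metric dist_real_def by blast
  obtain \<epsilon>2 where \<epsilon>2: "\<epsilon>2 > 0" "\<And>z. z \<in> ball z0 \<epsilon>2 \<Longrightarrow> Q' z"
    using PQ'(2) by (auto simp: eventually_nhds_metric dist_commute)
  show thesis
  proof (rule that[of \<rho> "min \<epsilon>1 \<epsilon>2" \<delta>])
    show "nonpos_free ?w z0 w z" if "w \<in> ball ?w \<rho>" "z \<in> ball z0 (min \<epsilon>1 \<epsilon>2)" for w z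
      using PQ(3) \<rho>(2) \<epsilon>1(2) that by auto
    show "0 < s \<and> s < 1 \<and> \<tau> s \<in> ball ?w \<rho>" if "\<bar>s - s0\<bar> < \<delta>" for s
      using \<delta>(2)[OF that] by blast
    show "logT s = logT s0 + Ln (\<tau> s / ?w)" if "\<bar>s - s0\<bar> < \<delta>" for s
      using \<delta>(2)[OF that] exp_logs(3)[OF s0] by simp
    show "logA (s, z) = logA (s0, z0) + Ln (baseA (\<tau> s) z / baseA ?w z0)"
      "logB (s, z) = logB (s0, z0) + Ln (baseB (\<tau> s) z / baseB ?w z0)"
      if "\<bar>s - s0\<bar> < \<delta>" "z \<in> ball z0 (min \<epsilon>1 \<epsilon>2)" for s z
      using PQ'(3)[of s z] \<delta>(2)[OF that(1)] \<epsilon>2(2)[of z] that(2) exp_logs(1,2)[OF s0 z0] by auto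
  qed (use \<rho>(1) \<epsilon>1(1) \<epsilon>2(1) \<delta>(1) in auto)
qed

end

lemma DERIV_transfer_nhds:
  "(g has_field_derivative d) (at x) \<Longrightarrow> \<forall>\<^sub>F y in nhds x. f y = g y \<Longrightarrow> (f has_field_derivative d) (at x)"
  using DERIV_cong_ev[OF refl _ refl] by blast

context branched_contour begin

lemma logZ_deriv:
  assumes "z + axis i t \<in> \<Omega>"
  shows "((\<lambda>t. logZ (z + axis i t)) has_field_derivative
     (axis i 1 :: complex ^ coord) $ Zp3 / (z + axis i t) $ Zp3) (at t)"
proof -
  let ?S = "(\<lambda>t. z + axis i t) -` \<Omega>"
  have op: "open ?S"
    using open_\<Omega> by (intro open_vimage continuous_intros)
  have "continuous_on ?S (\<lambda>t. logZ (z + axis i t))"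
    by (intro continuous_on_compose2[OF continuous_on_logZ] continuous_intros) auto
  then have "isCont (\<lambda>t. logZ (z + axis i t)) t"
    using op assms by (simp add: continuous_on_eq_continuous_at)
  moreover have "\<forall>\<^sub>F t in nhds t. exp (logZ (z + axis i t)) = (z + axis i t) $ Zp3"
    using eventually_nhds_in_open[OF op, of t] assms by (auto elim!: eventually_mono simp: exp_logZ)
  moreover have "((\<lambda>t. (z + axis i t) $ Zp3) has_derivative (*) ((axis i 1 :: complex ^ coord) $ Zp3)) (at t)"
    unfolding has_field_derivative_def[symmetric]
    by (auto simp: axis_component intro!: derivative_eq_intros)
  ultimately have "((\<lambda>t. logZ (z + axis i t)) has_derivative
      (\<lambda>h. (axis i 1 :: complex ^ coord) $ Zp3 * h / (z + axis i t) $ Zp3)) (at t)"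
    by (rule log_has_derivative)
  then show ?thesis
    by (rule has_derivative_imp_has_field_derivative) simp
qed

text \<open>A contour may be non-rectifiable near a point where it is not differentiable, so
  differentiation under the integral sign is not directly available.  Locally the integrand has a
  primitive in \<open>\<tau>\<close>, which allows a small piece of the contour to be replaced by a line segment.\<close>

lemma local_E_deriv:
  assumes s0: "0 < s0" "s0 < 1" and z0: "z0 \<in> \<Omega>"
  obtains \<delta> \<epsilon> where "\<delta> > 0" "\<epsilon> > 0" "ball z0 \<epsilon> \<subseteq> \<Omega>"
    "\<And>c d p q m r z. c \<le> s0 \<Longrightarrow> s0 \<le> d \<Longrightarrow> d - c < \<delta> \<Longrightarrow> z \<in> ball z0 \<epsilon> \<Longrightarrow>
       E p q m r z integrable_on {c..d}"
    "\<And>c d p q m r i. c \<le> s0 \<Longrightarrow> s0 \<le> d \<Longrightarrow> d - c < \<delta> \<Longrightarrow>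
       (\<lambda>s. E p q m r z0 s * log_deriv p q m i (\<tau> s) z0) integrable_on {c..d} \<and>
       ((\<lambda>t. integral {c..d} (E p q m r (z0 + axis i t))) has_field_derivative
          integral {c..d} (\<lambda>s. E p q m r z0 s * log_deriv p q m i (\<tau> s) z0)) (at 0)"
proof -
  obtain \<rho> \<epsilon> \<delta> where pos: "\<rho> > 0" "\<epsilon> > 0" "\<delta> > 0"
    and free: "\<And>w z. w \<in> ball (\<tau> s0) \<rho> \<Longrightarrow> z \<in> ball z0 \<epsilon> \<Longrightarrow> nonpos_free (\<tau> s0) z0 w z"
    and near: "\<And>s. \<bar>s - s0\<bar> < \<delta> \<Longrightarrow> 0 < s \<and> s < 1 \<and> \<tau> s \<in> ball (\<tau> s0) \<rho>"
    and LA: "\<And>s z. \<bar>s - s0\<bar> < \<delta> \<Longrightarrow> z \<in> ball z0 \<epsilon> \<Longrightarrow>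
       logA (s, z) = logA (s0, z0) + Ln (baseA (\<tau> s) z / baseA (\<tau> s0) z0)"
    and LB: "\<And>s z. \<bar>s - s0\<bar> < \<delta> \<Longrightarrow> z \<in> ball z0 \<epsilon> \<Longrightarrow>
       logB (s, z) = logB (s0, z0) + Ln (baseB (\<tau> s) z / baseB (\<tau> s0) z0)"
    and LT: "\<And>s. \<bar>s - s0\<bar> < \<delta> \<Longrightarrow> logT s = logT s0 + Ln (\<tau> s / \<tau> s0)"
    using local_logs[OF assms] by blast
  let ?W = "ball (\<tau> s0) \<rho>" and ?Z = "ball z0 \<epsilon>"
  have w0: "\<tau> s0 \<noteq> 0" and nz: "baseA (\<tau> s0) z0 \<noteq> 0" "baseB (\<tau> s0) z0 \<noteq> 0"
    using exp_logs(4) bases_nonzero s0 z0 by blast+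
  have fr: "w \<noteq> 0" "z \<in> \<Omega>" "w / \<tau> s0 \<notin> \<real>\<^sub>\<le>\<^sub>0" "baseA w z / baseA (\<tau> s0) z0 \<notin> \<real>\<^sub>\<le>\<^sub>0"
      "baseB w z / baseB (\<tau> s0) z0 \<notin> \<real>\<^sub>\<le>\<^sub>0" if "w \<in> ?W" "z \<in> ?Z" for w z
    using free[OF that] by (auto simp: nonpos_free_def)
  have AB: "baseA w z \<noteq> 0" "baseB w z \<noteq> 0" "z $ Zp3 \<noteq> 0" if "w \<in> ?W" "z \<in> ?Z" for w z
    using fr(4,5)[OF that] exp_logZ[OF fr(2)[OF that]] by auto
  have sub: "?Z \<subseteq> \<Omega>"
    using fr(2)[of "\<tau> s0"] pos(1) by auto
  \<comment> \<open>This is the integrand without \<open>\<tau>'\<close>, extended from the contour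
    to a disc in the variable \<open>w = \<tau> s\<close>. \<open>logZ\<close> is kept as it stands
    because it does not involve \<open>w\<close>.\<close>
  define \<phi> where "\<phi> p q m r w z = exp (p * (logA (s0, z0) + Ln (baseA w z / baseA (\<tau> s0) z0)) +
      q * (logB (s0, z0) + Ln (baseB w z / baseB (\<tau> s0) z0)) + m * logZ z +
      r * (logT s0 + Ln (w / \<tau> s0)))" for p q m r w z
  have E_eq: "E p q m r z s = \<phi> p q m r (\<tau> s) z * \<tau>' s" if "\<bar>s - s0\<bar> < \<delta>" "z \<in> ?Z" for p q m r z s
    unfolding E_def \<phi>_def LA[OF that] LB[OF that] LT[OF that(1)] ..
  have hol: "(\<lambda>w. \<phi> p q m r w z) holomorphic_on ?W" if "z \<in> ?Z" for p q m r z
    unfolding \<phi>_def using fr[OF _ that] nz w0 unfolding baseA_def baseB_def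
    by (intro holomorphic_intros) auto
  have holD: "(\<lambda>w. log_deriv p q m i w z0) holomorphic_on ?W" for p q m i
    unfolding log_deriv_def using AB(1,2)[of _ z0] fr(1)[of _ z0] pos(2) unfolding baseA_def baseB_def
    by (intro holomorphic_intros) auto
  have deriv: "((\<lambda>t. \<phi> p q m r w (z0 + axis i t)) has_field_derivative
      \<phi> p q m r w (z0 + axis i t) * log_deriv p q m i w (z0 + axis i t)) (at t within X)"
    if w: "w \<in> ?W" and t: "t \<in> ball 0 \<epsilon>" for p q m r w i t X
  proof -
    have z: "z0 + axis i t \<in> ?Z"
      using t by (simp add: dist_norm norm_axis_complex)
    note f = fr[OF w z]
    have "((\<lambda>t. baseA w (z0 + axis i t) / baseA (\<tau> s0) z0) has_field_derivative
        baseA w (axis i 1) / baseA (\<tau> s0) z0) (at t within X)"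
      unfolding baseA_add_axis using nz by (auto intro!: derivative_eq_intros)
    from DERIV_chain2[OF has_field_derivative_Ln[OF f(4)] this]
    have 1: "((\<lambda>t. Ln (baseA w (z0 + axis i t) / baseA (\<tau> s0) z0)) has_field_derivative
        baseA w (axis i 1) / baseA w (z0 + axis i t)) (at t within X)"
      using nz by simp
    have "((\<lambda>t. baseB w (z0 + axis i t) / baseB (\<tau> s0) z0) has_field_derivative
        baseB w (axis i 1) / baseB (\<tau> s0) z0) (at t within X)"
      unfolding baseB_add_axis using nz by (auto intro!: derivative_eq_intros)
    from DERIV_chain2[OF has_field_derivative_Ln[OF f(5)] this]
    have 2: "((\<lambda>t. Ln (baseB w (z0 + axis i t) / baseB (\<tau> s0) z0)) has_field_derivative
        baseB w (axis i 1) / baseB w (z0 + axis i t)) (at t within X)"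
      using nz by simp
    note 3 = has_field_derivative_at_within[OF logZ_deriv[OF f(2)], of X]
    from DERIV_add[OF DERIV_add[OF DERIV_add[OF DERIV_cmult[OF DERIV_add[OF DERIV_const 1]]
        DERIV_cmult[OF DERIV_add[OF DERIV_const 2]]] DERIV_cmult[OF 3]] DERIV_const]
    have "((\<lambda>t. p * (logA (s0, z0) + Ln (baseA w (z0 + axis i t) / baseA (\<tau> s0) z0)) +
      q * (logB (s0, z0) + Ln (baseB w (z0 + axis i t) / baseB (\<tau> s0) z0)) + m * logZ (z0 + axis i t) +
      r * (logT s0 + Ln (w / \<tau> s0))) has_field_derivative log_deriv p q m i w (z0 + axis i t)) (at t within X)"
      by (simp add: log_deriv_def)
    from DERIV_chain2[OF DERIV_exp this] show ?thesis
      unfolding \<phi>_def .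
  qed
  show thesis
  proof (rule that[OF pos(3,2) sub])
    fix c d assume cd: "c \<le> s0" "s0 \<le> d" "d - c < \<delta>"
    have abs: "\<bar>s - s0\<bar> < \<delta>" if "s \<in> {c..d}" for s
      using that cd by auto
    have ball: "\<tau> s \<in> ?W" if "s \<in> {c..d}" for s
      using near[OF abs[OF that]] by blast
    have int01: "{c..d} \<subseteq> {0<..<1}"
      using near[OF abs] by auto
    have "c \<in> {c..d}" "d \<in> {c..d}"
      using cd by auto
    then have "0 < c" "d < 1"
      using int01 by auto
    then obtain S where S: "finite S" "\<And>s. s \<in> {c<..<d} - S \<Longrightarrow> (\<tau> has_vector_derivative \<tau>' s) (at s)"
      using differentiable_off_finite by blast
    have path: "((\<lambda>s. g (\<tau> s) * \<tau>' s) has_integral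
        integral {0..1} (\<lambda>x. g (linepath (\<tau> c) (\<tau> d) x) * (\<tau> d - \<tau> c))) {c..d}"
      if "g holomorphic_on ?W" for g
      using has_integral_along_path[OF that _ continuous_on_subset[OF continuous_on_\<tau> int01] ball S] cd by auto
    have Ei: "(E p q m r z has_integral
        integral {0..1} (\<lambda>x. \<phi> p q m r (linepath (\<tau> c) (\<tau> d) x) z * (\<tau> d - \<tau> c))) {c..d}"
      if "z \<in> ?Z" for p q m r z
      by (rule has_integral_eq[OF _ path[OF hol[OF that]]]) (use E_eq[OF abs that] in auto)
    show "E p q m r z integrable_on {c..d}" if "z \<in> ?Z" for p q m r z
      using Ei[OF that] by (rule has_integral_integrable)
    fix p q m r i
    let ?D = "\<lambda>s. E p q m r z0 s * log_deriv p q m i (\<tau> s) z0"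
    let ?l = "linepath (\<tau> c) (\<tau> d)"
    have z0Z: "z0 \<in> ?Z"
      using pos(2) by simp
    have Di: "(?D has_integral integral {0..1}
        (\<lambda>x. \<phi> p q m r (?l x) z0 * log_deriv p q m i (?l x) z0 * (\<tau> d - \<tau> c))) {c..d}"
      by (rule has_integral_eq[OF _ path[OF holomorphic_on_mult[OF hol[OF z0Z] holD]]])
        (use E_eq[OF abs z0Z] in auto)
    have line: "?l x \<in> ?W" if "x \<in> {0..1}" for x
    proof -
      have "?l x \<in> closed_segment (\<tau> c) (\<tau> d)"
        using that linepath_in_path by auto
      then show ?thesis
        using closed_segment_subset[OF ball ball convex_ball, of c d] cd
        by (meson atLeastAtMost_iff order_refl order_trans subsetD)
    qed
    have Zm: "z0 + axis i t \<in> ?Z" if "t \<in> ball 0 \<epsilon>" for t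
      using that by (simp add: dist_norm norm_axis_complex)
    have cl: "continuous_on ({0..1::real}) ?l"
      by (rule continuous_on_linepath)
    have cont: "continuous_on (ball 0 \<epsilon> \<times> {0..1})
        (\<lambda>(t, x). \<phi> p q m r (?l x) (z0 + axis i t) * log_deriv p q m i (?l x) (z0 + axis i t) * (\<tau> d - \<tau> c))"
    proof -
      let ?P = "?W \<times> ?Z"
      have m: "fst x \<in> ?W" "snd x \<in> ?Z" if "x \<in> ?P" for x
        using that by auto
      note f = fr[OF m] and f' = AB[OF m]
      have cA: "continuous_on ?P (\<lambda>x. baseA (fst x) (snd x))"
        by (intro continuous_on_baseA continuous_intros f(1))
      have cB: "continuous_on ?P (\<lambda>x. baseB (fst x) (snd x))"
        by (intro continuous_on_baseB continuous_intros f(1))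
      have cZ: "continuous_on ?P (\<lambda>x. logZ (snd x))"
        by (intro continuous_on_compose2[OF continuous_on_logZ] continuous_intros) (use sub in auto)
      have "continuous_on ?P (\<lambda>x. \<phi> p q m r (fst x) (snd x))"
        unfolding \<phi>_def using nz w0
        by (intro continuous_on_exp continuous_on_add continuous_on_mult continuous_on_const
            continuous_on_Ln' continuous_on_divide cA cB cZ continuous_on_fst continuous_on_id f(3,4,5)) auto
      moreover have "continuous_on ?P (\<lambda>x. log_deriv p q m i (fst x) (snd x))"
        unfolding log_deriv_def
        by (intro continuous_on_add continuous_on_mult continuous_on_const continuous_on_baseA continuous_on_baseB
            continuous_on_divide cA cB continuous_on_fst continuous_on_snd continuous_on_id
            continuous_on_component f(1) ballI f')
      ultimately have cP: "continuous_on ?P (\<lambda>x. \<phi> p q m r (fst x) (snd x) * log_deriv p q m i (fst x) (snd x) * (\<tau> d - \<tau> c))"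
        by (intro continuous_on_mult continuous_on_const)
      have "continuous_on (ball 0 \<epsilon> \<times> {0..1}) (\<lambda>x. ?l (snd x))"
        by (intro continuous_on_compose2[OF cl] continuous_intros) auto
      then have "continuous_on (ball 0 \<epsilon> \<times> {0..1}) (\<lambda>x. (?l (snd x), z0 + axis i (fst x)))"
        by (rule continuous_on_Pair) (intro continuous_intros)
      moreover have "(\<lambda>x. (?l (snd x), z0 + axis i (fst x))) ` (ball 0 \<epsilon> \<times> {0..1}) \<subseteq> ?P"
        using line Zm by (intro image_subsetI SigmaI) (simp_all only: mem_Times_iff)
      ultimately have "continuous_on (ball 0 \<epsilon> \<times> {0..1}) (\<lambda>x. (\<lambda>x. \<phi> p q m r (fst x) (snd x) *
          log_deriv p q m i (fst x) (snd x) * (\<tau> d - \<tau> c)) (?l (snd x), z0 + axis i (fst x)))"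
        by (rule continuous_on_compose2[OF cP])
      then show ?thesis
        by (simp only: split_def fst_conv snd_conv)
    qed
    \<comment> \<open>On the segment the derivative in \<open>t\<close> is jointly continuous, so
      the Leibniz rule applies there; on the contour itself the factor \<open>\<tau>'\<close> could
      be unbounded.\<close>
    have "((\<lambda>t. integral (cbox 0 1) (\<lambda>x. \<phi> p q m r (?l x) (z0 + axis i t) * (\<tau> d - \<tau> c))) has_field_derivative
        integral (cbox 0 1) (\<lambda>x. \<phi> p q m r (?l x) (z0 + axis i 0) * log_deriv p q m i (?l x) (z0 + axis i 0) * (\<tau> d - \<tau> c)))
        (at 0 within ball 0 \<epsilon>)"
    proof (rule leibniz_rule_field_derivative[where U = "ball 0 \<epsilon>"])
      show "((\<lambda>t. \<phi> p q m r (?l x) (z0 + axis i t) * (\<tau> d - \<tau> c)) has_field_derivative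
          \<phi> p q m r (?l x) (z0 + axis i t) * log_deriv p q m i (?l x) (z0 + axis i t) * (\<tau> d - \<tau> c)) (at t within ball 0 \<epsilon>)"
        if "t \<in> ball 0 \<epsilon>" "x \<in> cbox 0 1" for t x
        using deriv[OF line that(1)] that(2) by (intro DERIV_cmult_right) auto
      show "(\<lambda>x. \<phi> p q m r (?l x) (z0 + axis i t) * (\<tau> d - \<tau> c)) integrable_on cbox 0 1"
        if t: "t \<in> ball 0 \<epsilon>" for t
      proof -
        have "continuous_on {0..1} (\<lambda>x. \<phi> p q m r (?l x) (z0 + axis i t))"
          by (intro continuous_on_compose2[OF holomorphic_on_imp_continuous_on[OF hol[OF Zm[OF t]]] cl])
            (use line in auto)
        then show ?thesis
          unfolding cbox_interval by (intro integrable_continuous_real continuous_intros)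
      qed
    qed (use cont pos in \<open>auto simp: cbox_interval\<close>)
    then have "((\<lambda>t. integral {0..1} (\<lambda>x. \<phi> p q m r (?l x) (z0 + axis i t) * (\<tau> d - \<tau> c))) has_field_derivative
        integral {c..d} ?D) (at 0)"
      using pos(2) integral_unique[OF Di] by (simp add: at_within_open[of 0 "ball 0 \<epsilon>"] axis_zero cbox_interval)
    moreover have "\<forall>\<^sub>F t in nhds 0. integral {c..d} (E p q m r (z0 + axis i t)) =
        integral {0..1} (\<lambda>x. \<phi> p q m r (?l x) (z0 + axis i t) * (\<tau> d - \<tau> c))"
      by (intro eventually_mono[OF eventually_add_axis_mem[OF open_ball z0Z]] integral_unique Ei)
    ultimately show "?D integrable_on {c..d} \<and>
       ((\<lambda>t. integral {c..d} (E p q m r (z0 + axis i t))) has_field_derivative integral {c..d} ?D) (at 0)"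
      using has_integral_integrable[OF Di] by (blast intro: DERIV_transfer_nhds)
  qed
qed

text \<open>Integrability on small intervals around each point is combined over adjacent intervals;
  bisection carries it to every compact piece of the contour.\<close>

lemma E_integrable:
  assumes ab: "0 < a" "b < 1" and z: "z \<in> \<Omega>"
  shows "E p q m r z integrable_on {a..b}"
proof (cases "a \<le> b")
  case True
  define P where "P c d \<longleftrightarrow> E p q m r z integrable_on {c..d}" for c d
  have "P a b"
    using True
  proof (induction rule: Bolzano)
    case (trans c d e)
    then show ?case
      unfolding P_def by (rule Henstock_Kurzweil_Integration.integrable_combine[rotated 2])
  next
    case (local s)
    have s: "0 < s" "s < 1"
      using local ab by auto
    show ?case
    proof (rule local_E_deriv[OF s z])
      fix \<delta> \<epsilon> :: real
      assume "\<delta> > 0" "\<epsilon> > 0" and *: "\<And>c d p q m r w. c \<le> s \<Longrightarrow> s \<le> d \<Longrightarrow> d - c < \<delta> \<Longrightarrow> w \<in> ball z \<epsilon> \<Longrightarrow>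
        E p q m r w integrable_on {c..d}"
      show ?case
        unfolding P_def using \<open>\<delta> > 0\<close> \<open>\<epsilon> > 0\<close> by (intro exI[of _ \<delta>] conjI allI impI *) auto
    qed
  qed
  then show ?thesis
    by (simp add: P_def)
qed auto

text \<open>Both sides are additive in the interval, so the local differentiation rule extends by
  bisection.\<close>

lemma integral_E_deriv:
  assumes ab: "0 < a" "b < 1" and z: "z \<in> \<Omega>"
  shows "((\<lambda>t. integral {a..b} (E p q m r (z + axis i t))) has_field_derivative
    integral {a..b} (\<lambda>s. E p q m r z s * log_deriv p q m i (\<tau> s) z)) (at 0)"
proof (cases "a \<le> b")
  case True
  let ?D = "\<lambda>s. E p q m r z s * log_deriv p q m i (\<tau> s) z"
  \<comment> \<open>Integrability of the differentiated integrand is carried along because splitting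
    its integral requires it. The bounds \<open>a \<le> c\<close> and \<open>d \<le> b\<close> keep
    all subintervals inside the open unit interval.\<close>
  define P where "P c d \<longleftrightarrow> (a \<le> c \<longrightarrow> d \<le> b \<longrightarrow> ?D integrable_on {c..d} \<and>
    ((\<lambda>t. integral {c..d} (E p q m r (z + axis i t))) has_field_derivative integral {c..d} ?D) (at 0))" for c d
  have "P a b"
    using True
  proof (induction rule: Bolzano)
    case (trans c d e)
    show ?case
      unfolding P_def
    proof (intro impI)
      assume ce: "a \<le> c" "e \<le> b"
      have Di: "?D integrable_on {c..d}" "?D integrable_on {d..e}"
        and der: "((\<lambda>t. integral {c..d} (E p q m r (z + axis i t))) has_field_derivative integral {c..d} ?D) (at 0)"
          "((\<lambda>t. integral {d..e} (E p q m r (z + axis i t))) has_field_derivative integral {d..e} ?D) (at 0)"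
        using trans ce unfolding P_def by auto
      have Dc: "?D integrable_on {c..e}"
        using trans Di by (intro Henstock_Kurzweil_Integration.integrable_combine[of c d e]) auto
      have "\<forall>\<^sub>F t in nhds 0. integral {c..e} (E p q m r (z + axis i t)) =
          integral {c..d} (E p q m r (z + axis i t)) + integral {d..e} (E p q m r (z + axis i t))"
        using eventually_add_axis_mem[OF open_\<Omega> z, of i]
      proof eventually_elim
        case (elim t)
        have "E p q m r (z + axis i t) integrable_on {c..e}"
          using ce ab elim by (intro E_integrable) auto
        then show ?case
          using trans by (intro Henstock_Kurzweil_Integration.integral_combine[symmetric]) auto
      qed
      moreover have "integral {c..e} ?D = integral {c..d} ?D + integral {d..e} ?D"
        using trans Dc by (intro Henstock_Kurzweil_Integration.integral_combine[symmetric]) auto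
      ultimately show "?D integrable_on {c..e} \<and>
          ((\<lambda>t. integral {c..e} (E p q m r (z + axis i t))) has_field_derivative integral {c..e} ?D) (at 0)"
        using Dc DERIV_transfer_nhds[OF DERIV_add[OF der]] by simp
    qed
  next
    case (local s)
    have s: "0 < s" "s < 1"
      using local ab by auto
    show ?case
    proof (rule local_E_deriv[OF s z])
      fix \<delta> \<epsilon> :: real
      assume "\<delta> > 0" and *: "\<And>c d p q m r i. c \<le> s \<Longrightarrow> s \<le> d \<Longrightarrow> d - c < \<delta> \<Longrightarrow>
       (\<lambda>s. E p q m r z s * log_deriv p q m i (\<tau> s) z) integrable_on {c..d} \<and>
       ((\<lambda>t. integral {c..d} (E p q m r (z + axis i t))) has_field_derivative
          integral {c..d} (\<lambda>s. E p q m r z s * log_deriv p q m i (\<tau> s) z)) (at 0)"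
      have "P c d" if "c \<le> s" "s \<le> d" "d - c < \<delta>" for c d
        unfolding P_def using *[OF that] by blast
      then show ?case
        using \<open>\<delta> > 0\<close> by blast
    qed
  qed
  then show ?thesis
    by (simp add: P_def)
qed auto

end

section \<open>Derivatives of the improper integral\<close>

lemma has_pds_on_cmult: "has_pds_on f \<Omega> \<Longrightarrow> has_pds_on (\<lambda>z. c * f z) \<Omega>"
  unfolding has_pds_on_def by (auto intro!: derivative_intros)

lemma has_pds_on_const: "has_pds_on (\<lambda>z. c) \<Omega>"
  unfolding has_pds_on_def by (auto intro!: derivative_intros)

lemma pd_cmult:
  assumes "has_pds_on f \<Omega>" "z \<in> \<Omega>"
  shows "pd i (\<lambda>z. c * f z) z = c * pd i f z"
  using assms unfolding pd_def has_pds_on_def by (intro deriv_cmult) auto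

lemma baseA_axis: "baseA w (axis i 1) = (case i of Zp1 \<Rightarrow> 1 | Zm2 \<Rightarrow> - inverse w | _ \<Rightarrow> 0)"
  by (cases i) (simp_all add: baseA_def axis_component)

lemma baseB_axis: "baseB w (axis i 1) = (case i of Zp2 \<Rightarrow> 1 | Zm1 \<Rightarrow> inverse w | _ \<Rightarrow> 0)"
  by (cases i) (simp_all add: baseB_def axis_component)

section \<open>Truncated integrals and shifts of their exponents\<close>

context branched_contour begin

text \<open>Raising an exponent by 1 multiplies by \<open>exp\<close> of the corresponding
  logarithm, which is the base itself whatever the branch.\<close>

lemma E_shift:
  assumes "0 < s" "s < 1" "z \<in> \<Omega>"
  shows "E p q m r z s = baseA (\<tau> s) z * E (p - 1) q m r z s"
    and "E p q m r z s = baseB (\<tau> s) z * E p (q - 1) m r z s"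
    and "E p q m r z s = z $ Zp3 * E p q (m - 1) r z s"
    and "E p q m r z s = \<tau> s * E p q m (r - 1) z s"
proof -
  show "E p q m r z s = baseA (\<tau> s) z * E (p - 1) q m r z s"
    unfolding exp_logs(1)[OF assms, symmetric] E_def mult.assoc[symmetric] exp_add[symmetric]
    by (simp add: algebra_simps)
  show "E p q m r z s = baseB (\<tau> s) z * E p (q - 1) m r z s"
    unfolding exp_logs(2)[OF assms, symmetric] E_def mult.assoc[symmetric] exp_add[symmetric]
    by (simp add: algebra_simps)
  show "E p q m r z s = z $ Zp3 * E p q (m - 1) r z s"
    unfolding exp_logZ[OF assms(3), symmetric] E_def mult.assoc[symmetric] exp_add[symmetric]
    by (simp add: algebra_simps)
  have "exp (logT s) * exp (p * logA (s, z) + q * logB (s, z) + m * logZ z + (r - 1) * logT s) =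
      exp (p * logA (s, z) + q * logB (s, z) + m * logZ z + r * logT s)"
    unfolding exp_add[symmetric] by (simp add: algebra_simps)
  then show "E p q m r z s = \<tau> s * E p q m (r - 1) z s"
    unfolding exp_logs(3)[OF assms(1,2)] E_def by (metis mult.assoc)
qed

definition J :: "complex \<Rightarrow> complex \<Rightarrow> complex \<Rightarrow> complex \<Rightarrow> real \<Rightarrow> real \<Rightarrow> complex ^ coord \<Rightarrow> complex" where
  "J p q m r a b z = integral {a..b} (E p q m r z)"

text \<open>These are the partial derivatives of \<open>J\<close>, expressed within the same family,
  so that second derivatives come from the same formula. The coordinates z_{-2} and z_{-1} enter
  with a factor 1 / \<tau>, hence differentiation in them lowers \<open>r\<close> too; z_{-3} does
  not occur in the integrand.\<close>

definition dJ :: "coord \<Rightarrow> complex \<Rightarrow> complex \<Rightarrow> complex \<Rightarrow> complex \<Rightarrow> real \<Rightarrow> real \<Rightarrow> complex ^ coord \<Rightarrow> complex" where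
  "dJ i p q m r a b z = (case i of
     Zp1 \<Rightarrow> p * J (p - 1) q m r a b z
   | Zm2 \<Rightarrow> - p * J (p - 1) q m (r - 1) a b z
   | Zp2 \<Rightarrow> q * J p (q - 1) m r a b z
   | Zm1 \<Rightarrow> q * J p (q - 1) m (r - 1) a b z
   | Zp3 \<Rightarrow> m * J p q (m - 1) r a b z
   | Zm3 \<Rightarrow> 0)"

lemma E_log_deriv:
  assumes "0 < s" "s < 1" "z \<in> \<Omega>"
  shows "E p q m r z s * log_deriv p q m i (\<tau> s) z = (case i of
     Zp1 \<Rightarrow> p * E (p - 1) q m r z s
   | Zm2 \<Rightarrow> - p * E (p - 1) q m (r - 1) z s
   | Zp2 \<Rightarrow> q * E p (q - 1) m r z s
   | Zm1 \<Rightarrow> q * E p (q - 1) m (r - 1) z s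
   | Zp3 \<Rightarrow> m * E p q (m - 1) r z s
   | Zm3 \<Rightarrow> 0)"
proof -
  note nz = bases_nonzero[OF assms] exp_logs(4)[OF assms(1,2)]
  have A: "E (p - 1) q m r z s = E p q m r z s / baseA (\<tau> s) z"
    and B: "E p (q - 1) m r z s = E p q m r z s / baseB (\<tau> s) z"
    and Z: "E p q (m - 1) r z s = E p q m r z s / z $ Zp3"
    and T: "E p q m (r - 1) z s = inverse (\<tau> s) * E p q m r z s" for p q m r
    by (subst E_shift(1)[OF assms, of p] E_shift(2)[OF assms, of p q] E_shift(3)[OF assms, of p q m]
      E_shift(4)[OF assms, of p q m r], use nz in simp)+
  show ?thesis
    by (cases i) (simp_all add: log_deriv_def baseA_axis baseB_axis axis_component
      A B Z T divide_inverse)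
qed

lemma J_deriv:
  assumes ab: "0 < a" "b < 1" and z: "z \<in> \<Omega>"
  shows "((\<lambda>t. J p q m r a b (z + axis i t)) has_field_derivative dJ i p q m r a b z) (at 0)"
proof -
  have "integral {a..b} (\<lambda>s. E p q m r z s * log_deriv p q m i (\<tau> s) z) =
    integral {a..b} (\<lambda>s. case i of
     Zp1 \<Rightarrow> p * E (p - 1) q m r z s
   | Zm2 \<Rightarrow> - p * E (p - 1) q m (r - 1) z s
   | Zp2 \<Rightarrow> q * E p (q - 1) m r z s
   | Zm1 \<Rightarrow> q * E p (q - 1) m (r - 1) z s
   | Zp3 \<Rightarrow> m * E p q (m - 1) r z s
   | Zm3 \<Rightarrow> 0)"
    using ab z by (intro Henstock_Kurzweil_Integration.integral_cong E_log_deriv) auto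
  also have "\<dots> = dJ i p q m r a b z"
    unfolding dJ_def J_def by (cases i) simp_all
  finally show ?thesis
    using integral_E_deriv[OF assms, of p q m r i] unfolding J_def by simp
qed

lemma pd_J: "0 < a \<Longrightarrow> b < 1 \<Longrightarrow> z \<in> \<Omega> \<Longrightarrow> pd i (J p q m r a b) z = dJ i p q m r a b z"
  by (intro pd_eqI J_deriv)

lemma has_pds_on_J: "0 < a \<Longrightarrow> b < 1 \<Longrightarrow> has_pds_on (J p q m r a b) \<Omega>"
  unfolding has_pds_on_def field_differentiable_def using J_deriv by blast

lemma has_pds_on_dJ:
  assumes "0 < a" "b < 1"
  shows "has_pds_on (dJ i p q m r a b) \<Omega>"
  unfolding dJ_def
  by (cases i; simp only: coord.case; intro has_pds_on_cmult has_pds_on_J has_pds_on_const assms)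

text \<open>With the exponents of \<open>K\<close> and \<open>r = \<nu>\<close> this is the function
  A^p B^q z_3^\<mu> \<tau>^\<nu> whose increments obstruct the eigenvalue equations; with
  \<open>r = \<nu> - 1\<close> it is the prescribed boundary function times z_3^\<mu>.\<close>

definition H :: "complex \<Rightarrow> complex \<Rightarrow> complex \<Rightarrow> complex \<Rightarrow> complex ^ coord \<Rightarrow> real \<Rightarrow> complex" where
  "H p q m r z s = exp (p * logA (s, z) + q * logB (s, z) + m * logZ z + r * logT s)"

lemma E_eq_H: "E p q m r z s = H p q m r z s * \<tau>' s"
  by (simp add: E_def H_def)

lemma log_has_vector_derivative:
  fixes L f :: "real \<Rightarrow> complex"
  assumes "isCont L s" "\<forall>\<^sub>F x in nhds s. exp (L x) = f x" "(f has_vector_derivative d) (at s)"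
  shows "(L has_vector_derivative d / f s) (at s)"
  using log_has_derivative[OF assms(1,2) assms(3)[unfolded has_vector_derivative_def]]
  by (simp add: has_vector_derivative_def scaleR_conv_of_real)

lemma continuous_on_H:
  "z \<in> \<Omega> \<Longrightarrow> continuous_on {0<..<1} (H p q m r z)"
  unfolding H_def by (intro continuous_intros continuous_on_logA1 continuous_on_logB1 continuous_on_logT)

lemma logT_has_vector_derivative:
  assumes s: "0 < s" "s < 1" and \<tau>: "(\<tau> has_vector_derivative \<tau>' s) (at s)"
  shows "(logT has_vector_derivative \<tau>' s / \<tau> s) (at s)"
proof (rule log_has_vector_derivative[OF _ _ \<tau>])
  show "isCont logT s"
    using continuous_on_logT s by (simp add: continuous_on_eq_continuous_at)
  show "\<forall>\<^sub>F x in nhds s. exp (logT x) = \<tau> x"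
    using eventually_nhds_in_open[of "{0<..<1}" s] s by (auto elim!: eventually_mono simp: exp_logs)
qed

text \<open>Logarithmic differentiation along the contour. Since dA/d\<tau> = z_{-2} \<tau>^{-2} and
  dB/d\<tau> = - z_{-1} \<tau>^{-2}, the first two terms lower \<open>r\<close> by 2, the last one
  by 1.\<close>

lemma H_has_vector_derivative:
  assumes s: "0 < s" "s < 1" and z: "z \<in> \<Omega>" and \<tau>: "(\<tau> has_vector_derivative \<tau>' s) (at s)"
  shows "(H p q m r z has_vector_derivative
    p * z $ Zm2 * E (p - 1) q m (r - 2) z s - q * z $ Zm1 * E p (q - 1) m (r - 2) z s + r * E p q m (r - 1) z s) (at s)"
proof -
  have ev: "\<forall>\<^sub>F x in nhds s. x \<in> {0<..<1}"
    using s by (intro eventually_nhds_in_open) auto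
  note nz = bases_nonzero[OF s z] exp_logs(4)[OF s]
  have inv: "((\<lambda>x. inverse (\<tau> x)) has_vector_derivative - (\<tau>' s * inverse (\<tau> s) * inverse (\<tau> s))) (at s)"
    using field_vector_diff_chain_at[OF \<tau> DERIV_inverse[OF nz(4)]]
    by (simp add: o_def power2_eq_square mult_ac)
  have dA: "((\<lambda>x. baseA (\<tau> x) z) has_vector_derivative z $ Zm2 * \<tau>' s * inverse (\<tau> s) * inverse (\<tau> s)) (at s)"
    unfolding baseA_def by (auto intro!: derivative_eq_intros inv)
  have dB: "((\<lambda>x. baseB (\<tau> x) z) has_vector_derivative - (z $ Zm1 * \<tau>' s * inverse (\<tau> s) * inverse (\<tau> s))) (at s)"
    unfolding baseB_def by (auto intro!: derivative_eq_intros inv)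
  have 1: "((\<lambda>x. logA (x, z)) has_vector_derivative
      z $ Zm2 * \<tau>' s * inverse (\<tau> s) * inverse (\<tau> s) / baseA (\<tau> s) z) (at s)"
    using continuous_on_logA1[OF z] s ev z
    by (intro log_has_vector_derivative dA) (auto simp: continuous_on_eq_continuous_at exp_logs elim!: eventually_mono)
  have 2: "((\<lambda>x. logB (x, z)) has_vector_derivative
      - (z $ Zm1 * \<tau>' s * inverse (\<tau> s) * inverse (\<tau> s)) / baseB (\<tau> s) z) (at s)"
    using continuous_on_logB1[OF z] s ev z
    by (intro log_has_vector_derivative dB) (auto simp: continuous_on_eq_continuous_at exp_logs elim!: eventually_mono)
  note 3 = logT_has_vector_derivative[OF s \<tau>]
  have "((\<lambda>x. p * logA (x, z) + q * logB (x, z) + m * logZ z + r * logT x) has_vector_derivative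
     p * (z $ Zm2 * \<tau>' s * inverse (\<tau> s) * inverse (\<tau> s) / baseA (\<tau> s) z) +
     q * (- (z $ Zm1 * \<tau>' s * inverse (\<tau> s) * inverse (\<tau> s)) / baseB (\<tau> s) z) + 0 + r * (\<tau>' s / \<tau> s)) (at s)"
    by (intro has_vector_derivative_add has_vector_derivative_mult_right has_vector_derivative_const 1 2 3)
  from field_vector_diff_chain_at[OF this DERIV_exp]
  have "(H p q m r z has_vector_derivative
     (p * (z $ Zm2 * \<tau>' s * inverse (\<tau> s) * inverse (\<tau> s) / baseA (\<tau> s) z) +
     q * (- (z $ Zm1 * \<tau>' s * inverse (\<tau> s) * inverse (\<tau> s)) / baseB (\<tau> s) z) + 0 + r * (\<tau>' s / \<tau> s)) *
     H p q m r z s) (at s)"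
    by (simp add: H_def[abs_def] o_def)
  moreover have "E (p - 1) q m (r - 2) z s = E p q m r z s * inverse (\<tau> s) * inverse (\<tau> s) / baseA (\<tau> s) z"
    using nz E_shift(1)[OF s z, of p q m r] E_shift(4)[OF s z, of "p - 1" q m r] E_shift(4)[OF s z, of "p - 1" q m "r - 1"]
    by (simp add: field_simps)
  moreover have "E p (q - 1) m (r - 2) z s = E p q m r z s * inverse (\<tau> s) * inverse (\<tau> s) / baseB (\<tau> s) z"
    using nz E_shift(2)[OF s z, of p q m r] E_shift(4)[OF s z, of p "q - 1" m r] E_shift(4)[OF s z, of p "q - 1" m "r - 1"]
    by (simp add: field_simps)
  moreover have "E p q m (r - 1) z s = E p q m r z s / \<tau> s"
    using nz E_shift(4)[OF s z, of p q m r] by (simp add: field_simps)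
  ultimately show ?thesis
    by (simp add: E_eq_H algebra_simps)
qed

text \<open>The fundamental theorem applies across the corners of the contour because
  \<open>H\<close> is continuous there.\<close>

lemma J_exact:
  assumes ab: "0 < a" "a \<le> b" "b < 1" and z: "z \<in> \<Omega>"
  shows "p * z $ Zm2 * J (p - 1) q m (r - 2) a b z - q * z $ Zm1 * J p (q - 1) m (r - 2) a b z + r * J p q m (r - 1) a b z
    = H p q m r z b - H p q m r z a"
proof -
  obtain S where S: "finite S" "\<And>s. s \<in> {a<..<b} - S \<Longrightarrow> (\<tau> has_vector_derivative \<tau>' s) (at s)"
    using differentiable_off_finite ab by blast
  let ?f = "\<lambda>s. p * z $ Zm2 * E (p - 1) q m (r - 2) z s - q * z $ Zm1 * E p (q - 1) m (r - 2) z s + r * E p q m (r - 1) z s"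
  have "(?f has_integral H p q m r z b - H p q m r z a) {a..b}"
  proof (rule fundamental_theorem_of_calculus_interior_strong[OF S(1) ab(2)])
    show "(H p q m r z has_vector_derivative ?f s) (at s)" if "s \<in> {a<..<b} - S" for s
      using that ab by (intro H_has_vector_derivative z S) auto
    show "continuous_on {a..b} (H p q m r z)"
      using ab by (intro continuous_on_subset[OF continuous_on_H[OF z]]) auto
  qed
  moreover have "(?f has_integral
      p * z $ Zm2 * J (p - 1) q m (r - 2) a b z - q * z $ Zm1 * J p (q - 1) m (r - 2) a b z + r * J p q m (r - 1) a b z) {a..b}"
    unfolding J_def using E_integrable[OF ab(1,3) z]
    by (intro has_integral_add has_integral_diff has_integral_mult_right integrable_integral)
  ultimately show ?thesis
    by (rule has_integral_unique[rotated])
qed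

text \<open>Write one factor of the power as A = z_1 - z_{-2} / \<tau>, B = z_2 + z_{-1} / \<tau> or
  z_3 and integrate. These relations remove the explicit coordinates that \<open>N1\<close>,
  \<open>N2\<close>, \<open>N3\<close> produce.\<close>

lemma J_shift:
  assumes ab: "0 < a" "b < 1" and z: "z \<in> \<Omega>"
  shows "z $ Zm2 * J (p - 1) q m (r - 1) a b z = z $ Zp1 * J (p - 1) q m r a b z - J p q m r a b z"
    and "z $ Zm1 * J p (q - 1) m (r - 1) a b z = J p q m r a b z - z $ Zp2 * J p (q - 1) m r a b z"
    and "z $ Zp3 * J p q (m - 1) r a b z = J p q m r a b z"
proof -
  have int: "(E p q m r z has_integral J p q m r a b z) {a..b}" for p q m r
    unfolding J_def using E_integrable[OF assms] by (rule integrable_integral)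
  have T: "E p q m (r - 1) z s = inverse (\<tau> s) * E p q m r z s" if "0 < s" "s < 1" for p q m r s
    using E_shift(4)[OF that z, of p q m r] exp_logs(4)[OF that] by (simp add: field_simps)
  have eq: "z $ Zm2 * E (p - 1) q m (r - 1) z s = z $ Zp1 * E (p - 1) q m r z s - E p q m r z s"
    "z $ Zm1 * E p (q - 1) m (r - 1) z s = E p q m r z s - z $ Zp2 * E p (q - 1) m r z s"
    "z $ Zp3 * E p q (m - 1) r z s = E p q m r z s"
    if "s \<in> {a..b}" for s
  proof -
    have s: "0 < s" "s < 1"
      using that ab by auto
    show "z $ Zm2 * E (p - 1) q m (r - 1) z s = z $ Zp1 * E (p - 1) q m r z s - E p q m r z s"
      unfolding T[OF s] E_shift(1)[OF s z, of p] by (simp add: baseA_def algebra_simps)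
    show "z $ Zm1 * E p (q - 1) m (r - 1) z s = E p q m r z s - z $ Zp2 * E p (q - 1) m r z s"
      unfolding T[OF s] E_shift(2)[OF s z, of p q] by (simp add: baseB_def algebra_simps)
    show "z $ Zp3 * E p q (m - 1) r z s = E p q m r z s"
      unfolding E_shift(3)[OF s z, of p q m] ..
  qed
  show "z $ Zm2 * J (p - 1) q m (r - 1) a b z = z $ Zp1 * J (p - 1) q m r a b z - J p q m r a b z"
    by (rule has_integral_unique[OF has_integral_eq[OF eq(1) has_integral_mult_right[OF int]]])
      (auto intro!: has_integral_diff has_integral_mult_right int)
  show "z $ Zm1 * J p (q - 1) m (r - 1) a b z = J p q m r a b z - z $ Zp2 * J p (q - 1) m r a b z"
    by (rule has_integral_unique[OF has_integral_eq[OF eq(2) has_integral_mult_right[OF int]]])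
      (auto intro!: has_integral_diff has_integral_mult_right int)
  show "z $ Zp3 * J p q (m - 1) r a b z = J p q m r a b z"
    by (rule has_integral_unique[OF has_integral_eq[OF eq(3) has_integral_mult_right[OF int]] int])
qed

end

section \<open>The improper integral, its derivatives and its eigenvalue defect\<close>

locale convergent_contour = branched_contour +
  fixes \<alpha> \<beta> \<mu> \<nu> :: complex
  assumes converges:
    "converges_locally_uniformly_on (integrand logA logB logT logZ \<tau> \<alpha> \<beta> \<mu> \<nu>) \<Omega>"
begin

abbreviation p :: complex where "p \<equiv> \<alpha> + \<nu>"
abbreviation q :: complex where "q \<equiv> \<beta> + \<nu>"

abbreviation ends :: "(real \<times> real) filter" where
  "ends \<equiv> at_right 0 \<times>\<^sub>F at_left 1"

abbreviation Kint :: "complex ^ coord \<Rightarrow> complex" where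
  "Kint \<equiv> K logA logB logT logZ \<tau> \<alpha> \<beta> \<mu> \<nu>"

definition inv_2pi_i :: complex where "inv_2pi_i = inverse (2 * of_real pi * \<i>)"

lemma inv_2pi_i_nonzero: "inv_2pi_i \<noteq> 0"
  by (simp add: inv_2pi_i_def)

definition Kpart :: "real \<times> real \<Rightarrow> complex ^ coord \<Rightarrow> complex" where
  "Kpart = (\<lambda>(a, b) z. inv_2pi_i * J p q \<mu> (\<nu> - 1) a b z)"

lemma integrand_eq:
  "integrand logA logB logT logZ \<tau> \<alpha> \<beta> \<mu> \<nu> z = (\<lambda>s. inv_2pi_i * E p q \<mu> (\<nu> - 1) z s)"
  by (rule ext) (simp only: integrand_def E_def branch_power_def exp_add inv_2pi_i_def divide_inverse mult_ac)

lemma Kpart_limit: "loc_uniform_limit \<Omega> Kpart Kint ends"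
proof -
  have "Kpart = (\<lambda>(a, b) z. integral {a..b} (integrand logA logB logT logZ \<tau> \<alpha> \<beta> \<mu> \<nu> z))"
    by (simp add: Kpart_def J_def integrand_eq fun_eq_iff)
  moreover have "Kint = (\<lambda>z. integral {0<..<1} (integrand logA logB logT logZ \<tau> \<alpha> \<beta> \<mu> \<nu> z))"
    by (simp add: K_def fun_eq_iff)
  ultimately show ?thesis
    using converges unfolding converges_locally_uniformly_on_def loc_uniform_limit_def by simp
qed

lemma ends_nontrivial: "ends \<noteq> bot"
  by (simp add: prod_filter_eq_bot)

lemma eventually_ends: "\<forall>\<^sub>F x in ends. 0 < fst x \<and> fst x < snd x \<and> snd x < 1"
proof -
  have "\<forall>\<^sub>F a in at_right (0::real). a \<in> {0<..<1/2}" "\<forall>\<^sub>F b in at_left (1::real). b \<in> {1/2<..<1}"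
    by (intro eventually_at_right_real eventually_at_left_real; simp)+
  then have "\<forall>\<^sub>F x in ends. fst x \<in> {0<..<1/2} \<and> snd x \<in> {1/2<..<1}"
    by (rule eventually_prodI)
  then show ?thesis
    by eventually_elim auto
qed

lemma Kpart_pd:
  assumes "0 < a" "b < 1"
  shows "has_pds_on (Kpart (a, b)) \<Omega>"
    and "z \<in> \<Omega> \<Longrightarrow> pd i (Kpart (a, b)) z = inv_2pi_i * dJ i p q \<mu> (\<nu> - 1) a b z"
    and "has_pds_on (pd i (Kpart (a, b))) \<Omega>"
proof -
  have Kp: "Kpart (a, b) = (\<lambda>z. inv_2pi_i * J p q \<mu> (\<nu> - 1) a b z)"
    by (simp add: Kpart_def)
  show "has_pds_on (Kpart (a, b)) \<Omega>"
    unfolding Kp by (intro has_pds_on_cmult has_pds_on_J assms)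
  show eq: "pd i (Kpart (a, b)) z = inv_2pi_i * dJ i p q \<mu> (\<nu> - 1) a b z" if "z \<in> \<Omega>" for z
    unfolding Kp pd_cmult[OF has_pds_on_J[OF assms] that] pd_J[OF assms that] ..
  show "has_pds_on (pd i (Kpart (a, b))) \<Omega>"
    by (rule has_pds_on_cong[OF open_\<Omega> eq has_pds_on_cmult[OF has_pds_on_dJ[OF assms]]])
qed

lemma Kint_has_pds: "has_pds_on Kint \<Omega>"
  and pd_Kint_limit: "loc_uniform_limit \<Omega> (\<lambda>x. pd i (Kpart x)) (pd i Kint) ends"
proof -
  have "\<forall>\<^sub>F x in ends. has_pds_on (Kpart x) \<Omega>"
    using eventually_ends by eventually_elim (metis Kpart_pd(1) prod.collapse)
  from loc_uniform_limit_has_pds_on[OF Kpart_limit ends_nontrivial this]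
    loc_uniform_limit_pd[OF Kpart_limit ends_nontrivial this]
  show "has_pds_on Kint \<Omega>" "loc_uniform_limit \<Omega> (\<lambda>x. pd i (Kpart x)) (pd i Kint) ends"
    by blast+
qed

text \<open>Termwise differentiation can be repeated, because the derivatives of the truncated
  integrals again have partial derivatives and converge locally uniformly.\<close>

lemma pd_Kint_has_pds: "has_pds_on (pd i Kint) \<Omega>"
  and pd_pd_Kint_limit: "loc_uniform_limit \<Omega> (\<lambda>x. pd j (pd i (Kpart x))) (pd j (pd i Kint)) ends"
proof -
  have "\<forall>\<^sub>F x in ends. has_pds_on (pd i (Kpart x)) \<Omega>"
    using eventually_ends by eventually_elim (metis Kpart_pd(3) prod.collapse)
  from loc_uniform_limit_has_pds_on[OF pd_Kint_limit ends_nontrivial this]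
    loc_uniform_limit_pd[OF pd_Kint_limit ends_nontrivial this]
  show "has_pds_on (pd i Kint) \<Omega>" "loc_uniform_limit \<Omega> (\<lambda>x. pd j (pd i (Kpart x))) (pd j (pd i Kint)) ends"
    by blast+
qed

lemma Kint_harmonic:
  assumes z: "z \<in> \<Omega>"
  shows "laplacian Kint z = 0"
proof -
  have ev: "\<forall>\<^sub>F x in ends. laplacian (Kpart x) z = 0"
    using eventually_ends
  proof eventually_elim
    case (elim x)
    obtain a b where x: "x = (a, b)" by force
    then have ab: "0 < a" "b < 1"
      using elim by auto
    have pd2: "pd j (pd i (Kpart x)) z = inv_2pi_i * pd j (dJ i p q \<mu> (\<nu> - 1) a b) z" for i j
      unfolding x using pd_cong[OF open_\<Omega> z Kpart_pd(2)[OF ab]] pd_cmult[OF has_pds_on_dJ[OF ab] z] by (rule trans)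
    \<comment> \<open>Both mixed derivatives lower all three exponents of A, B and \<tau> by 1. They
      are pq and - pq times the same integral and cancel in the Laplacian.\<close>
    have h1: "pd Zm1 (dJ Zp1 p q \<mu> (\<nu> - 1) a b) z = p * (q * J (p - 1) (q - 1) \<mu> (\<nu> - 1 - 1) a b z)"
      unfolding dJ_def[of Zp1] by (simp add: pd_cmult[OF has_pds_on_J[OF ab] z] pd_J[OF ab z] dJ_def)
    have h2: "pd Zm2 (dJ Zp2 p q \<mu> (\<nu> - 1) a b) z = q * (- p * J (p - 1) (q - 1) \<mu> (\<nu> - 1 - 1) a b z)"
      unfolding dJ_def[of Zp2] by (simp add: pd_cmult[OF has_pds_on_J[OF ab] z] pd_J[OF ab z] dJ_def)
    have h3: "pd Zm3 (dJ Zp3 p q \<mu> (\<nu> - 1) a b) z = 0"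
      unfolding dJ_def[of Zp3] by (simp add: pd_cmult[OF has_pds_on_J[OF ab] z] pd_J[OF ab z] dJ_def)
    show ?case
      unfolding laplacian_def pd2 h1 h2 h3 by (simp add: algebra_simps)
  qed
  have "((\<lambda>x. laplacian (Kpart x) z) \<longlongrightarrow> laplacian Kint z) ends"
    unfolding laplacian_def by (intro tendsto_intros loc_uniform_limit_tendsto[OF pd_pd_Kint_limit z])
  from tendsto_unique[OF ends_nontrivial this tendsto_eventually[OF ev]]
  show ?thesis .
qed

text \<open>After the shift relations, the left sides for \<open>N1\<close> and \<open>N2\<close>
  both become the left side of \<open>J_exact\<close> at \<open>r = \<nu>\<close>, because p -
  \<alpha> = q - \<beta> = \<nu>. The equation for \<open>N3\<close> is homogeneity in z_3 and has
  no boundary term.\<close>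

lemma Kpart_eigen:
  assumes ab: "0 < a" "a < b" "b < 1" and z: "z \<in> \<Omega>"
  shows "N1 (Kpart (a, b)) z - \<alpha> * Kpart (a, b) z = inv_2pi_i * (H p q \<mu> \<nu> z b - H p q \<mu> \<nu> z a)"
    and "N2 (Kpart (a, b)) z - \<beta> * Kpart (a, b) z = inv_2pi_i * (H p q \<mu> \<nu> z b - H p q \<mu> \<nu> z a)"
    and "N3 (Kpart (a, b)) z = \<mu> * Kpart (a, b) z"
proof -
  note pd = Kpart_pd(2)[OF ab(1,3) z]
  let ?J = "J p q \<mu> (\<nu> - 1) a b z" and ?A = "J (p - 1) q \<mu> (\<nu> - 1) a b z" and ?B = "J p (q - 1) \<mu> (\<nu> - 1) a b z"
    and ?A' = "J (p - 1) q \<mu> (\<nu> - 2) a b z" and ?B' = "J p (q - 1) \<mu> (\<nu> - 2) a b z"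
    and ?Z = "J p q (\<mu> - 1) (\<nu> - 1) a b z"
  have A: "z $ Zm2 * ?A' = z $ Zp1 * ?A - ?J" and B: "z $ Zm1 * ?B' = ?J - z $ Zp2 * ?B" and Z: "z $ Zp3 * ?Z = ?J"
    using J_shift[OF ab(1,3) z, of p q \<mu> "\<nu> - 1"] by simp_all
  have ex: "p * (z $ Zm2 * ?A') - q * (z $ Zm1 * ?B') + \<nu> * ?J = H p q \<mu> \<nu> z b - H p q \<mu> \<nu> z a"
    using J_exact[OF ab(1) _ ab(3) z, of p q \<mu> \<nu>] ab(2) by (simp add: mult.assoc)
  have "N1 (Kpart (a, b)) z - \<alpha> * Kpart (a, b) z = inv_2pi_i * (p * (z $ Zp1 * ?A) - q * (z $ Zm1 * ?B') - \<alpha> * ?J)"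
    unfolding N1_def pd by (simp add: Kpart_def dJ_def divide_inverse algebra_simps)
  also have "z $ Zp1 * ?A = z $ Zm2 * ?A' + ?J"
    using A by simp
  finally show "N1 (Kpart (a, b)) z - \<alpha> * Kpart (a, b) z = inv_2pi_i * (H p q \<mu> \<nu> z b - H p q \<mu> \<nu> z a)"
    unfolding ex[symmetric] by (simp add: divide_inverse algebra_simps)
  have "N2 (Kpart (a, b)) z - \<beta> * Kpart (a, b) z = inv_2pi_i * (p * (z $ Zm2 * ?A') + q * (z $ Zp2 * ?B) - \<beta> * ?J)"
    unfolding N2_def pd by (simp add: Kpart_def dJ_def divide_inverse algebra_simps)
  also have "z $ Zp2 * ?B = ?J - z $ Zm1 * ?B'"
    using B by simp
  finally show "N2 (Kpart (a, b)) z - \<beta> * Kpart (a, b) z = inv_2pi_i * (H p q \<mu> \<nu> z b - H p q \<mu> \<nu> z a)"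
    unfolding ex[symmetric] by (simp add: divide_inverse algebra_simps)
  have "N3 (Kpart (a, b)) z = inv_2pi_i * (\<mu> * (z $ Zp3 * ?Z))"
    unfolding N3_def pd by (simp add: dJ_def)
  then show "N3 (Kpart (a, b)) z = \<mu> * Kpart (a, b) z"
    unfolding Z by (simp add: Kpart_def)
qed

text \<open>Although defined through \<open>N1\<close>, the same function measures the failure of
  the equation for \<open>N2\<close>.\<close>

definition defect :: "complex ^ coord \<Rightarrow> complex" where
  "defect z = N1 Kint z - \<alpha> * Kint z"

lemma N_limits:
  assumes z: "z \<in> \<Omega>"
  shows "((\<lambda>x. N1 (Kpart x) z) \<longlongrightarrow> N1 Kint z) ends" "((\<lambda>x. N2 (Kpart x) z) \<longlongrightarrow> N2 Kint z) ends"
    "((\<lambda>x. N3 (Kpart x) z) \<longlongrightarrow> N3 Kint z) ends"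
  unfolding N1_def N2_def N3_def by (intro tendsto_intros loc_uniform_limit_tendsto[OF pd_Kint_limit z])+

text \<open>The identities for truncated integrals pass to the limit. The first part identifies the
  defect, up to the factor 1 / (2 pi i), with the difference of A^p B^q z_3^\<mu> \<tau>^\<nu> at
  the two ends.\<close>

lemma defect_limit:
  assumes z: "z \<in> \<Omega>"
  shows "((\<lambda>(a, b). H p q \<mu> \<nu> z b - H p q \<mu> \<nu> z a) \<longlongrightarrow> inverse inv_2pi_i * defect z) ends"
    and "N2 Kint z - \<beta> * Kint z = defect z"
    and "N3 Kint z = \<mu> * Kint z"
proof -
  note K = loc_uniform_limit_tendsto[OF Kpart_limit z]
  have ev: "\<forall>\<^sub>F x in ends. inverse inv_2pi_i * (N1 (Kpart x) z - \<alpha> * Kpart x z) = (\<lambda>(a, b). H p q \<mu> \<nu> z b - H p q \<mu> \<nu> z a) x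
      \<and> N1 (Kpart x) z - \<alpha> * Kpart x z = N2 (Kpart x) z - \<beta> * Kpart x z \<and> N3 (Kpart x) z = \<mu> * Kpart x z"
    using eventually_ends
  proof eventually_elim
    case (elim x)
    then show ?case
      using Kpart_eigen[OF _ _ _ z, of "fst x" "snd x"] by (auto simp: split_def inv_2pi_i_nonzero)
  qed
  have "((\<lambda>x. inverse inv_2pi_i * (N1 (Kpart x) z - \<alpha> * Kpart x z)) \<longlongrightarrow> inverse inv_2pi_i * defect z) ends"
    unfolding defect_def by (intro tendsto_intros N_limits z K)
  then show "((\<lambda>(a, b). H p q \<mu> \<nu> z b - H p q \<mu> \<nu> z a) \<longlongrightarrow> inverse inv_2pi_i * defect z) ends"
    by (rule Lim_transform_eventually) (use ev in eventually_elim, blast)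
  have "((\<lambda>x. N1 (Kpart x) z - \<alpha> * Kpart x z) \<longlongrightarrow> defect z) ends"
    unfolding defect_def by (intro tendsto_intros N_limits z K)
  then have "((\<lambda>x. N2 (Kpart x) z - \<beta> * Kpart x z) \<longlongrightarrow> defect z) ends"
    by (rule Lim_transform_eventually) (use ev in eventually_elim, blast)
  moreover have "((\<lambda>x. N2 (Kpart x) z - \<beta> * Kpart x z) \<longlongrightarrow> N2 Kint z - \<beta> * Kint z) ends"
    by (intro tendsto_intros N_limits z K)
  ultimately show "N2 Kint z - \<beta> * Kint z = defect z"
    by (rule tendsto_unique[OF ends_nontrivial, rotated])
  have "((\<lambda>x. \<mu> * Kpart x z) \<longlongrightarrow> N3 Kint z) ends"
    by (rule Lim_transform_eventually[OF N_limits(3)[OF z]]) (use ev in eventually_elim, blast)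
  moreover have "((\<lambda>x. \<mu> * Kpart x z) \<longlongrightarrow> \<mu> * Kint z) ends"
    by (intro tendsto_intros K)
  ultimately show "N3 Kint z = \<mu> * Kint z"
    by (rule tendsto_unique[OF ends_nontrivial])
qed

end

section \<open>Behaviour at the ends of the contour\<close>

lemma is_end_inside:
  assumes "is_end F"
  shows "\<forall>\<^sub>F s in F. 0 < s \<and> s < 1"
proof -
  obtain S where "S \<subseteq> {0<..<1}" "\<forall>\<^sub>F s in F. s \<in> S"
    using is_end_interval[OF assms, of "\<lambda>_. True"] by auto
  then show ?thesis
    by (auto elim!: eventually_mono)
qed

text \<open>Factor A(s) + u = A(s) (1 + u / A(s)). For small u the second factor avoids the cut, so
  uniqueness of continuous logarithms on the disc identifies the increment with its principal
  logarithm. Only 1 / A(s) has to converge, so the base itself may tend to infinity.\<close>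

lemma log_increment_limit:
  fixes \<Lambda> :: "real \<Rightarrow> complex \<Rightarrow> complex"
  assumes r: "r > 0"
    and \<Lambda>: "\<forall>\<^sub>F s in F. continuous_on (ball 0 r) (\<Lambda> s) \<and> (\<forall>u\<in>ball 0 r. exp (\<Lambda> s u) = A s + u)"
    and k: "((\<lambda>s. inverse (A s)) \<longlongrightarrow> k) F"
  obtains \<delta> where "0 < \<delta>" "\<delta> \<le> r"
    "\<And>u. u \<in> ball 0 \<delta> \<Longrightarrow> ((\<lambda>s. \<Lambda> s u - \<Lambda> s 0) \<longlongrightarrow> Ln (1 + u * k)) F"
proof -
  \<comment> \<open>Eventually 1 / A(s) has norm below \<open>norm k + 1\<close>, and then its
    product with any \<open>u\<close> in this disc has norm below 1.\<close>
  define \<delta> where "\<delta> = min r (1 / (norm k + 1))"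
  have \<delta>: "0 < \<delta>" "\<delta> \<le> r"
    using r by (auto simp: \<delta>_def add_nonneg_pos)
  have slit: "1 + u * c \<notin> \<real>\<^sub>\<le>\<^sub>0" if "u \<in> ball 0 \<delta>" "norm c < norm k + 1" for u c :: complex
  proof -
    have "norm u < 1 / (norm k + 1)"
      using that by (simp add: \<delta>_def)
    then have "norm u * (norm k + 1) < 1"
      by (subst (asm) pos_less_divide_eq) (auto simp: add_nonneg_pos)
    moreover have "norm u * norm c \<le> norm u * (norm k + 1)"
      using that by (intro mult_left_mono) auto
    ultimately have "norm (u * c) < 1"
      by (simp add: norm_mult)
    then have "Re (1 + u * c) > 0"
      using abs_Re_le_cmod[of "u * c"] by simp
    then show ?thesis
      by (auto simp: complex_nonpos_Reals_iff)
  qed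
  have "\<forall>\<^sub>F s in F. norm (inverse (A s)) < norm k + 1"
    using tendsto_norm[OF k] by (rule order_tendstoD) simp
  with \<Lambda> have eq: "\<forall>\<^sub>F s in F. \<forall>u\<in>ball 0 \<delta>. \<Lambda> s u - \<Lambda> s 0 = Ln (1 + u * inverse (A s))"
  proof eventually_elim
    case (elim s)
    have As: "A s = exp (\<Lambda> s 0)"
      using elim(1) r by auto
    show ?case
    proof
      fix u :: complex assume u: "u \<in> ball 0 \<delta>"
      have sub: "ball 0 \<delta> \<subseteq> (ball 0 r :: complex set)"
        using \<delta> by auto
      have "\<Lambda> s u = \<Lambda> s 0 + Ln (1 + u * inverse (A s))"
      proof (rule log_unique[of "ball 0 \<delta>" "\<Lambda> s" "\<lambda>u. \<Lambda> s 0 + Ln (1 + u * inverse (A s))" 0 u])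
        show "continuous_on (ball 0 \<delta>) (\<Lambda> s)"
          using elim(1) sub continuous_on_subset by blast
        show "continuous_on (ball 0 \<delta>) (\<lambda>u. \<Lambda> s 0 + Ln (1 + u * inverse (A s)))"
          by (intro continuous_intros) (rule slit[OF _ elim(2)])
        show "exp (\<Lambda> s v) = exp (\<Lambda> s 0 + Ln (1 + v * inverse (A s)))" if "v \<in> ball 0 \<delta>" for v
        proof -
          have "1 + v * inverse (A s) \<noteq> 0"
            using slit[OF that elim(2)] by auto
          then have "exp (\<Lambda> s 0 + Ln (1 + v * inverse (A s))) = A s * (1 + v * inverse (A s))"
            by (simp add: exp_add As)
          also have "\<dots> = A s + v"
            by (simp add: As algebra_simps exp_minus)
          finally show ?thesis
            using elim(1) that sub by auto
        qed
      qed (use u \<delta> in auto)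
      then show "\<Lambda> s u - \<Lambda> s 0 = Ln (1 + u * inverse (A s))"
        by simp
    qed
  qed
  show thesis
  proof (rule that[OF \<delta>])
    fix u :: complex assume u: "u \<in> ball 0 \<delta>"
    have n: "1 + u * k \<notin> \<real>\<^sub>\<le>\<^sub>0"
      by (rule slit[OF u]) simp
    have "((\<lambda>s. Ln (1 + u * inverse (A s))) \<longlongrightarrow> Ln (1 + u * k)) F"
      by (intro tendsto_intros k n)
    then show "((\<lambda>s. \<Lambda> s u - \<Lambda> s 0) \<longlongrightarrow> Ln (1 + u * k)) F"
      by (rule Lim_transform_eventually) (use eq in eventually_elim, use u in auto)
  qed
qed

text \<open>The two functions of \<open>u\<close> agree near 0, and their derivatives at 0 are
  \<open>p * k\<close> and \<open>p * l\<close>.\<close>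

lemma exp_Ln_slopes_eq:
  fixes p k l :: complex
  assumes "\<delta> > 0" "\<And>u. u \<in> ball 0 \<delta> \<Longrightarrow> exp (p * Ln (1 + u * k)) = exp (p * Ln (1 + u * l))"
  shows "p * k = p * l"
proof -
  have der: "((\<lambda>u. exp (p * Ln (1 + u * c))) has_field_derivative p * c) (at 0)" for c
    by (auto intro!: derivative_eq_intros)
  have ev: "\<forall>\<^sub>F u in nhds 0. exp (p * Ln (1 + u * k)) = exp (p * Ln (1 + u * l))"
    using eventually_nhds_in_open[of "ball 0 \<delta>" 0] assms by (auto elim!: eventually_mono)
  show ?thesis
    using DERIV_unique[OF der[of k] DERIV_transfer_nhds[OF der[of l] ev]] .
qed

text \<open>The function \<open>h\<close> stands for the common boundary value, along a line on which only one of the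
  two bases varies.  Its logarithmic derivative is computed at either end of the contour.\<close>

lemma end_slopes_eq:
  fixes \<Lambda> h :: "real \<Rightarrow> complex \<Rightarrow> complex"
  assumes F: "F \<noteq> bot" "F' \<noteq> bot" and r: "r > 0" and p: "p \<noteq> 0"
    and ev: "\<forall>\<^sub>F s in F. P s" "\<forall>\<^sub>F s in F'. P s"
    and \<Lambda>: "\<And>s. P s \<Longrightarrow> continuous_on (ball 0 r) (\<Lambda> s)"
      "\<And>s u. P s \<Longrightarrow> u \<in> ball 0 r \<Longrightarrow> exp (\<Lambda> s u) = A s + u"
      "\<And>s u. P s \<Longrightarrow> u \<in> ball 0 r \<Longrightarrow> h s u = h s 0 * exp (p * (\<Lambda> s u - \<Lambda> s 0))"
    and lim: "\<And>u. u \<in> ball 0 r \<Longrightarrow> \<exists>l. ((\<lambda>s. h s u) \<longlongrightarrow> l) F \<and> ((\<lambda>s. h s u) \<longlongrightarrow> l) F'"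
    and lim0: "((\<lambda>s. h s 0) \<longlongrightarrow> c) F" "((\<lambda>s. h s 0) \<longlongrightarrow> c) F'" "c \<noteq> 0"
    and k: "((\<lambda>s. inverse (A s)) \<longlongrightarrow> k) F" "((\<lambda>s. inverse (A s)) \<longlongrightarrow> k') F'"
  shows "k = k'"
proof -
  have "\<forall>\<^sub>F s in F. continuous_on (ball 0 r) (\<Lambda> s) \<and> (\<forall>u\<in>ball 0 r. exp (\<Lambda> s u) = A s + u)"
    "\<forall>\<^sub>F s in F'. continuous_on (ball 0 r) (\<Lambda> s) \<and> (\<forall>u\<in>ball 0 r. exp (\<Lambda> s u) = A s + u)"
    by (rule eventually_mono[OF ev(1)] eventually_mono[OF ev(2)], use \<Lambda> in blast)+
  note evs = this
  obtain \<delta> where \<delta>: "0 < \<delta>" "\<delta> \<le> r"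
    "\<And>u. u \<in> ball 0 \<delta> \<Longrightarrow> ((\<lambda>s. \<Lambda> s u - \<Lambda> s 0) \<longlongrightarrow> Ln (1 + u * k)) F"
    using log_increment_limit[OF r evs(1) k(1)] by blast
  obtain \<delta>' where \<delta>': "0 < \<delta>'" "\<delta>' \<le> r"
    "\<And>u. u \<in> ball 0 \<delta>' \<Longrightarrow> ((\<lambda>s. \<Lambda> s u - \<Lambda> s 0) \<longlongrightarrow> Ln (1 + u * k')) F'"
    using log_increment_limit[OF r evs(2) k(2)] by blast
  have "p * k = p * k'"
  proof (rule exp_Ln_slopes_eq[of "min \<delta> \<delta>'"])
    fix u :: complex assume u: "u \<in> ball 0 (min \<delta> \<delta>')"
    then have ur: "u \<in> ball 0 r" and u1: "u \<in> ball 0 \<delta>" and u2: "u \<in> ball 0 \<delta>'"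
      using \<delta>(2) by auto
    obtain l where l: "((\<lambda>s. h s u) \<longlongrightarrow> l) F" "((\<lambda>s. h s u) \<longlongrightarrow> l) F'"
      using lim[OF ur] by blast
    have "((\<lambda>s. h s 0 * exp (p * (\<Lambda> s u - \<Lambda> s 0))) \<longlongrightarrow> c * exp (p * Ln (1 + u * k))) F"
      by (intro tendsto_intros lim0 \<delta>(3) u1)
    moreover have "((\<lambda>s. h s 0 * exp (p * (\<Lambda> s u - \<Lambda> s 0))) \<longlongrightarrow> l) F"
      by (rule Lim_transform_eventually[OF l(1)], rule eventually_mono[OF ev(1)]) (rule \<Lambda>(3)[OF _ ur])
    ultimately have "c * exp (p * Ln (1 + u * k)) = l"
      by (rule tendsto_unique[OF F(1)])
    have "((\<lambda>s. h s 0 * exp (p * (\<Lambda> s u - \<Lambda> s 0))) \<longlongrightarrow> c * exp (p * Ln (1 + u * k'))) F'"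
      by (intro tendsto_intros lim0 \<delta>'(3) u2)
    moreover have "((\<lambda>s. h s 0 * exp (p * (\<Lambda> s u - \<Lambda> s 0))) \<longlongrightarrow> l) F'"
      by (rule Lim_transform_eventually[OF l(2)], rule eventually_mono[OF ev(2)]) (rule \<Lambda>(3)[OF _ ur])
    ultimately have "c * exp (p * Ln (1 + u * k')) = l"
      by (rule tendsto_unique[OF F(2)])
    then show "exp (p * Ln (1 + u * k)) = exp (p * Ln (1 + u * k'))"
      using \<open>c * exp (p * Ln (1 + u * k)) = l\<close> lim0(3) by (metis mult_cancel_left)
  qed (use \<delta> \<delta>' in auto)
  with p show ?thesis
    by simp
qed

section \<open>Branches at the ends and along coordinate lines\<close>

context branched_contour begin

text \<open>A finite limit of \<open>logT\<close> would give \<open>\<tau>\<close> a finite limit,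
  and then \<tau> times 1 / \<tau>, which is 1, would tend to 0.\<close>

lemma logT_diverges:
  assumes F: "is_end F" and \<tau>: "((\<lambda>s. inverse (\<tau> s)) \<longlongrightarrow> 0) F" and "(logT \<longlongrightarrow> l) F"
  shows False
proof -
  have "((\<lambda>s. exp (logT s) * inverse (\<tau> s)) \<longlongrightarrow> exp l * 0) F"
    by (intro tendsto_intros assms)
  moreover have "\<forall>\<^sub>F s in F. exp (logT s) * inverse (\<tau> s) = 1"
    using is_end_inside[OF F] by eventually_elim (simp add: exp_logs)
  ultimately have "((\<lambda>s. 1 :: complex) \<longlongrightarrow> 0) F"
    using tendsto_cong by fastforce
  then show False
    using tendsto_unique[OF is_end_nontrivial[OF F] tendsto_const] by fastforce
qed

lemma H_split: "H p q m r z s = exp (p * logA (s, z) + q * logB (s, z) + m * logZ z) * exp (r * logT s)"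
  unfolding H_def exp_add[symmetric] ..

lemma H_shift: "0 < s \<Longrightarrow> s < 1 \<Longrightarrow> H p q m r z s = \<tau> s * H p q m (r - 1) z s"
  unfolding exp_logs(3)[symmetric] H_def exp_add[symmetric] by (simp add: algebra_simps)

lemma H_nonzero: "H p q m r z s \<noteq> 0"
  by (simp add: H_def)

text \<open>Moving in a coordinate absent from a base keeps the base fixed. Its branch is then a
  continuous logarithm of a constant on a disc and cannot jump by multiples of 2 pi i.\<close>

lemma logs_along_axis:
  assumes s: "0 < s" "s < 1" and ball: "\<And>u. u \<in> ball 0 r \<Longrightarrow> z + axis i u \<in> \<Omega>"
  shows "continuous_on (ball 0 r) (\<lambda>u. logA (s, z + axis i u))"
    and "continuous_on (ball 0 r) (\<lambda>u. logB (s, z + axis i u))"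
    and "continuous_on (ball 0 r) (\<lambda>u. logZ (z + axis i u))"
    and "u \<in> ball 0 r \<Longrightarrow> i \<noteq> Zp1 \<Longrightarrow> i \<noteq> Zm2 \<Longrightarrow> logA (s, z + axis i u) = logA (s, z)"
    and "u \<in> ball 0 r \<Longrightarrow> i \<noteq> Zp2 \<Longrightarrow> i \<noteq> Zm1 \<Longrightarrow> logB (s, z + axis i u) = logB (s, z)"
    and "u \<in> ball 0 r \<Longrightarrow> i \<noteq> Zp3 \<Longrightarrow> logZ (z + axis i u) = logZ z"
proof -
  show A: "continuous_on (ball 0 r) (\<lambda>u. logA (s, z + axis i u))"
    by (rule continuous_on_compose2[OF continuous_on_logA])
      (use s ball in \<open>auto intro!: continuous_intros\<close>)
  show B: "continuous_on (ball 0 r) (\<lambda>u. logB (s, z + axis i u))"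
    by (rule continuous_on_compose2[OF continuous_on_logB])
      (use s ball in \<open>auto intro!: continuous_intros\<close>)
  show Z: "continuous_on (ball 0 r) (\<lambda>u. logZ (z + axis i u))"
    by (rule continuous_on_compose2[OF continuous_on_logZ])
      (use ball in \<open>auto intro!: continuous_intros\<close>)
  assume u: "u \<in> ball 0 r"
  then have r: "0 \<in> ball 0 r"
    by (auto intro: le_less_trans[OF norm_ge_zero])
  then have z: "z \<in> \<Omega>"
    using ball[of 0] by (simp add: axis_zero)
  show "logA (s, z + axis i u) = logA (s, z)" if i: "i \<noteq> Zp1" "i \<noteq> Zm2"
  proof (rule log_unique[OF _ A continuous_on_const _ r _ u])
    show "exp (logA (s, z + axis i v)) = exp (logA (s, z))" if "v \<in> ball 0 r" for v
      unfolding exp_logs(1)[OF s ball[OF that]] exp_logs(1)[OF s z]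
      using i by (cases i) (simp_all add: baseA_add_axis baseA_axis)
  qed (simp_all add: axis_zero)
  show "logB (s, z + axis i u) = logB (s, z)" if i: "i \<noteq> Zp2" "i \<noteq> Zm1"
  proof (rule log_unique[OF _ B continuous_on_const _ r _ u])
    show "exp (logB (s, z + axis i v)) = exp (logB (s, z))" if "v \<in> ball 0 r" for v
      unfolding exp_logs(2)[OF s ball[OF that]] exp_logs(2)[OF s z]
      using i by (cases i) (simp_all add: baseB_add_axis baseB_axis)
  qed (simp_all add: axis_zero)
  show "logZ (z + axis i u) = logZ z" if i: "i \<noteq> Zp3"
  proof (rule log_unique[OF _ Z continuous_on_const _ r _ u])
    show "exp (logZ (z + axis i v)) = exp (logZ z)" if "v \<in> ball 0 r" for v
      unfolding exp_logZ[OF ball[OF that]] exp_logZ[OF z] using i by (simp add: axis_component)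
  qed (simp_all add: axis_zero)
qed

end

context convergent_contour begin

text \<open>The increment of \<open>H\<close> converges as the two end points move independently,
  which forces a separate limit at each end.\<close>

lemma H_end_limits:
  assumes z: "z \<in> \<Omega>"
  obtains g0 g1 where "(H p q \<mu> \<nu> z \<longlongrightarrow> g0) (at_right 0)" "(H p q \<mu> \<nu> z \<longlongrightarrow> g1) (at_left 1)"
    "g1 - g0 = inverse inv_2pi_i * defect z"
  using tendsto_difference_prod_filter[OF defect_limit(1)[OF z] trivial_limit_at_right_real trivial_limit_at_left_real]
  by blast

text \<open>This reads the convergence of the improper integral at one end: a primitive available
  only near that end differs by a constant from the integral taken from an interior point, hence has
  a limit.\<close>

lemma E_primitive_converges:
  assumes z: "z \<in> \<Omega>" and F: "is_end F" and S: "is_interval S" "S \<subseteq> {0<..<1}" "\<forall>\<^sub>F s in F. s \<in> S"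
    and P: "\<And>a b. a \<in> S \<Longrightarrow> b \<in> S \<Longrightarrow> a \<le> b \<Longrightarrow> J p q \<mu> (\<nu> - 1) a b z = P b - P a"
  obtains l where "(P \<longlongrightarrow> l) F"
proof -
  let ?J = "\<lambda>a b. J p q \<mu> (\<nu> - 1) a b z"
  have comb: "?J a c + ?J c b = ?J a b" if "0 < a" "a \<le> c" "c \<le> b" "b < 1" for a b c
    unfolding J_def using that by (intro Henstock_Kurzweil_Integration.integral_combine E_integrable z)
  \<comment> \<open>The oriented integral from the base point 1/2, a primitive on the whole open
    unit interval.\<close>
  define I where "I s = (if 1/2 \<le> s then ?J (1/2) s else - ?J s (1/2))" for s
  have J_I: "?J a b = I b - I a" if "0 < a" "a \<le> b" "b < 1" for a b
    using comb[of a "1/2" b] comb[of "1/2" a b] comb[of a b "1/2"] that by (auto simp: I_def algebra_simps)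
  have "((\<lambda>x. inverse inv_2pi_i * Kpart x z) \<longlongrightarrow> inverse inv_2pi_i * Kint z) ends"
    by (intro tendsto_intros loc_uniform_limit_tendsto[OF Kpart_limit z])
  then have "((\<lambda>(a, b). I b - I a) \<longlongrightarrow> inverse inv_2pi_i * Kint z) ends"
  proof (rule Lim_transform_eventually)
    show "\<forall>\<^sub>F x in ends. inverse inv_2pi_i * Kpart x z = (case x of (a, b) \<Rightarrow> I b - I a)"
      using eventually_ends
      by eventually_elim (auto simp: Kpart_def inv_2pi_i_nonzero J_I split: prod.split)
  qed
  then obtain l0 l1 where "(I \<longlongrightarrow> l0) (at_right 0)" "(I \<longlongrightarrow> l1) (at_left 1)"
    using tendsto_difference_prod_filter[OF _ trivial_limit_at_right_real trivial_limit_at_left_real] by blast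
  then obtain l where l: "(I \<longlongrightarrow> l) F"
    using F unfolding is_end_def by blast
  obtain s0 where s0: "s0 \<in> S"
    using eventually_happens'[OF is_end_nontrivial[OF F] S(3)] by blast
  have d: "P b - P a = I b - I a" if "a \<in> S" "b \<in> S" "a \<le> b" for a b
    using P[OF that] J_I[of a b] S(2) that by force
  have "P s = I s + (P s0 - I s0)" if "s \<in> S" for s
  proof (cases "s \<le> s0")
    case True
    from d[OF that s0 this] show ?thesis
      by algebra
  next
    case False
    then have "s0 \<le> s"
      by simp
    from d[OF s0 that this] show ?thesis
      by algebra
  qed
  then have "\<forall>\<^sub>F s in F. I s + (P s0 - I s0) = P s"
    by (intro eventually_mono[OF S(3)]) simp
  then have "(P \<longlongrightarrow> l + (P s0 - I s0)) F"
    by (rule Lim_transform_eventually[rotated]) (intro tendsto_intros l)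
  then show thesis
    by (rule that)
qed

end

context convergent_contour begin

text \<open>If the contour runs into infinity and \<open>H\<close> has a nonzero limit there, then \<open>\<nu> = 0\<close> and the integral
  diverges logarithmically: in terms of \<open>w = 1 / \<tau>\<close> it is the integral of \<open>- \<phi> w / w\<close> with \<open>\<phi>\<close>
  holomorphic and nonzero at \<open>0\<close>.\<close>

lemma not_infinite_end:
  assumes z: "z \<in> \<Omega>" "z $ Zp1 \<noteq> 0" "z $ Zp2 \<noteq> 0" and F: "is_end F"
    and g: "(H p q \<mu> \<nu> z \<longlongrightarrow> g) F" "g \<noteq> 0" and h: "(H p q \<mu> (\<nu> - 1) z \<longlongrightarrow> 0) F"
  shows False
proof -
  note inside = is_end_inside[OF F]
  have "((\<lambda>s. H p q \<mu> (\<nu> - 1) z s / H p q \<mu> \<nu> z s) \<longlongrightarrow> 0 / g) F"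
    by (intro tendsto_intros g h)
  then have "((\<lambda>s. H p q \<mu> (\<nu> - 1) z s / H p q \<mu> \<nu> z s) \<longlongrightarrow> 0) F"
    by simp
  \<comment> \<open>The two functions differ by one power of \<tau>, so their quotient is 1 / \<tau>
    and the contour runs into infinity.\<close>
  then have w: "((\<lambda>s. inverse (\<tau> s)) \<longlongrightarrow> 0) F"
  proof (rule Lim_transform_eventually)
    show "\<forall>\<^sub>F s in F. H p q \<mu> (\<nu> - 1) z s / H p q \<mu> \<nu> z s = inverse (\<tau> s)"
      using inside
    proof eventually_elim
      case (elim s)
      then show ?case
        using H_shift[of s p q \<mu> \<nu> z] H_nonzero[of p q \<mu> "\<nu> - 1" z s] exp_logs(4)[of s]
        by (simp add: field_simps)
    qed
  qed
  have "((\<lambda>s. z $ Zp1 - inverse (\<tau> s) * z $ Zm2) \<longlongrightarrow> z $ Zp1 - 0 * z $ Zm2) F"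
    by (intro tendsto_intros w)
  then have "((\<lambda>s. baseA (\<tau> s) z) \<longlongrightarrow> z $ Zp1) F"
    by (simp add: baseA_def)
  then have "((\<lambda>s. exp (logA (s, z))) \<longlongrightarrow> z $ Zp1) F"
    by (rule Lim_transform_eventually) (use inside in eventually_elim, simp add: exp_logs z)
  then obtain lA where lA: "((\<lambda>s. logA (s, z)) \<longlongrightarrow> lA) F" "exp lA = z $ Zp1"
    using log_converges_at_end[OF F continuous_on_logA1[OF z(1)] _ z(2)] by blast
  have "((\<lambda>s. z $ Zp2 + inverse (\<tau> s) * z $ Zm1) \<longlongrightarrow> z $ Zp2 + 0 * z $ Zm1) F"
    by (intro tendsto_intros w)
  then have "((\<lambda>s. baseB (\<tau> s) z) \<longlongrightarrow> z $ Zp2) F"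
    by (simp add: baseB_def)
  then have "((\<lambda>s. exp (logB (s, z))) \<longlongrightarrow> z $ Zp2) F"
    by (rule Lim_transform_eventually) (use inside in eventually_elim, simp add: exp_logs z)
  then obtain lB where lB: "((\<lambda>s. logB (s, z)) \<longlongrightarrow> lB) F" "exp lB = z $ Zp2"
    using log_converges_at_end[OF F continuous_on_logB1[OF z(1)] _ z(3)] by blast
  show False
  \<comment> \<open>For \<nu> \<noteq> 0 the power \<tau>^\<nu> has a finite nonzero limit, which
    already makes \<open>logT\<close> converge. For \<nu> = 0 the convergence of the integral has to
    be used.\<close>
  proof (cases "\<nu> = 0")
    case False
    let ?X = "\<lambda>s. p * logA (s, z) + q * logB (s, z) + \<mu> * logZ z"
    have "((\<lambda>s. H p q \<mu> \<nu> z s / exp (?X s)) \<longlongrightarrow> g / exp (p * lA + q * lB + \<mu> * logZ z)) F"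
      by (intro tendsto_intros g lA lB) simp
    then have "((\<lambda>s. exp (\<nu> * logT s)) \<longlongrightarrow> g / exp (p * lA + q * lB + \<mu> * logZ z)) F"
      by (simp add: H_split)
    moreover have "continuous_on {0<..<1} (\<lambda>s. \<nu> * logT s)"
      by (intro continuous_intros continuous_on_logT)
    ultimately obtain l where "((\<lambda>s. \<nu> * logT s) \<longlongrightarrow> l) F"
      using log_converges_at_end[OF F] g(2) by (metis divide_eq_0_iff exp_not_eq_zero)
    then have "((\<lambda>s. inverse \<nu> * (\<nu> * logT s)) \<longlongrightarrow> inverse \<nu> * l) F"
      by (intro tendsto_intros)
    then have "(logT \<longlongrightarrow> inverse \<nu> * l) F"
      using False by (simp add: mult.assoc[symmetric])
    then show False
      by (rule logT_diverges[OF F w])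
  next
    case True
    \<comment> \<open>With w = 1 / \<tau> the bases are A = z_1 (1 - x w) and B = z_2 (1 - y w). The
      radius \<open>\<rho>\<close> keeps x w and y w in the unit disc.\<close>
    define x where "x = z $ Zm2 / z $ Zp1"
    define y where "y = - z $ Zm1 / z $ Zp2"
    define \<rho> where "\<rho> = 1 / (1 + norm x + norm y)"
    have \<rho>: "\<rho> > 0"
      by (simp add: \<rho>_def add_pos_nonneg)
    have slit: "1 - c * w \<notin> \<real>\<^sub>\<le>\<^sub>0" if "w \<in> ball 0 \<rho>" "norm c \<le> norm x + norm y" for c w :: complex
    proof -
      have "norm w * (1 + norm x + norm y) < 1"
        using that(1) by (simp add: \<rho>_def pos_less_divide_eq add_pos_nonneg)
      moreover have "norm w * norm c \<le> norm w * (1 + norm x + norm y)"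
        using that(2) by (intro mult_left_mono) auto
      ultimately have "norm (c * w) < 1"
        by (simp add: norm_mult mult.commute)
      then have "Re (1 - c * w) > 0"
        using abs_Re_le_cmod[of "c * w"] by simp
      then show ?thesis
        by (auto simp: complex_nonpos_Reals_iff)
    qed
    define \<phi> where "\<phi> w = exp (p * (lA + Ln (1 - x * w)) + q * (lB + Ln (1 - y * w)) + \<mu> * logZ z)" for w
    have hol\<phi>: "\<phi> holomorphic_on ball 0 \<rho>"
      unfolding \<phi>_def by (intro holomorphic_intros slit) auto
    \<comment> \<open>The difference quotient of \<open>\<phi>\<close> at 0, holomorphic across its
      removable singularity. Its primitive \<open>Q\<close> takes up the part of the integral that
      converges.\<close>
    define k where "k = (\<lambda>w. if w = 0 then deriv \<phi> 0 else (\<phi> w - \<phi> 0) / (w - 0))"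
    have k: "k w = (\<phi> w - \<phi> 0) / w" if "w \<noteq> 0" for w
      using that by (simp add: k_def)
    have hol: "k holomorphic_on ball 0 \<rho>"
      unfolding k_def by (rule pole_lemma_open[OF hol\<phi> open_ball])
    obtain Q where Q': "\<And>w. w \<in> ball 0 \<rho> \<Longrightarrow> (Q has_field_derivative k w) (at w within ball 0 \<rho>)"
      using holomorphic_convex_primitive'[OF convex_ball open_ball hol] by blast
    have Q: "(Q has_field_derivative k w) (at w)" if "w \<in> ball 0 \<rho>" for w
      using Q'[OF that] unfolding at_within_open[OF that open_ball] .
    have "\<forall>\<^sub>F s in F. exp (logA (s, z)) = baseA (\<tau> s) z" "\<forall>\<^sub>F s in F. exp (logB (s, z)) = baseB (\<tau> s) z"
      using inside by (eventually_elim, simp add: exp_logs z)+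
    from log_eq_add_Ln[OF lA(1) this(1)] log_eq_add_Ln[OF lB(1) this(2)]
    have "\<forall>\<^sub>F s in F. logA (s, z) = lA + Ln (1 - x * inverse (\<tau> s))" "\<forall>\<^sub>F s in F. logB (s, z) = lB + Ln (1 - y * inverse (\<tau> s))"
      using z(2,3) by (simp_all add: lA(2) lB(2) baseA_def baseB_def x_def y_def diff_divide_distrib add_divide_distrib mult.commute)
    moreover have "\<forall>\<^sub>F s in F. inverse (\<tau> s) \<in> ball 0 \<rho>"
      using \<rho> by (intro topological_tendstoD[OF w]) auto
    ultimately have "\<forall>\<^sub>F s in F. inverse (\<tau> s) \<in> ball 0 \<rho> \<and> H p q \<mu> \<nu> z s = \<phi> (inverse (\<tau> s))"
      by eventually_elim (simp add: H_def \<phi>_def True)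
    then obtain S where S: "is_interval S" "S \<subseteq> {0<..<1}" "\<forall>\<^sub>F s in F. s \<in> S"
      "\<And>s. s \<in> S \<Longrightarrow> inverse (\<tau> s) \<in> ball 0 \<rho> \<and> H p q \<mu> \<nu> z s = \<phi> (inverse (\<tau> s))"
      using is_end_interval[OF F] by blast
    \<comment> \<open>As d\<tau> / \<tau> = - dw / w, the form \<phi>(w) d\<tau> / \<tau> is the sum
      of \<phi>(0) d\<tau> / \<tau> and - k(w) dw. Convergence of this primitive therefore makes
      \<open>logT\<close> converge.\<close>
    define P where "P s = \<phi> 0 * logT s - Q (inverse (\<tau> s))" for s
    have "J p q \<mu> (\<nu> - 1) a b z = P b - P a" if ab: "a \<in> S" "b \<in> S" "a \<le> b" for a b
    proof -
      have sub: "{a..b} \<subseteq> S"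
        using mem_is_interval_1_I[OF S(1) ab(1,2)] by auto
      have sub01: "{a..b} \<subseteq> {0<..<1}"
        using sub S(2) by blast
      have "a \<in> {0<..<1}" "b \<in> {0<..<1}"
        using ab S(2) by blast+
      then obtain X where X: "finite X" "\<And>s. s \<in> {a<..<b} - X \<Longrightarrow> (\<tau> has_vector_derivative \<tau>' s) (at s)"
        using differentiable_off_finite[of a b] by (metis greaterThanLessThan_iff)
      have "(E p q \<mu> (\<nu> - 1) z has_integral P b - P a) {a..b}"
      proof (rule fundamental_theorem_of_calculus_interior_strong[OF X(1) ab(3)])
        have inv: "continuous_on {a..b} (\<lambda>s. inverse (\<tau> s))"
          using sub01 exp_logs(4) by (intro continuous_intros continuous_on_subset[OF continuous_on_\<tau>]) auto
        have "continuous_on (ball 0 \<rho>) Q"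
          using Q DERIV_isCont continuous_at_imp_continuous_on by blast
        from continuous_on_compose2[OF this inv] have "continuous_on {a..b} (\<lambda>s. Q (inverse (\<tau> s)))"
          using S(4) sub by blast
        then show "continuous_on {a..b} P"
          unfolding P_def by (intro continuous_intros continuous_on_subset[OF continuous_on_logT sub01])
        fix s assume s: "s \<in> {a<..<b} - X"
        then have sS: "s \<in> S"
          using sub by auto
        then have s01: "0 < s" "s < 1"
          using S(2) by auto
        note \<tau> = X(2)[OF s]
        note nz = exp_logs(4)[OF s01]
        have "((\<lambda>x. inverse (\<tau> x)) has_vector_derivative \<tau>' s * - (inverse (\<tau> s) ^ Suc (Suc 0))) (at s)"
          using field_vector_diff_chain_at[OF \<tau> DERIV_inverse[OF nz]] by (simp add: o_def)
        from field_vector_diff_chain_at[OF this Q[of "inverse (\<tau> s)"]]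
        have "((\<lambda>x. Q (inverse (\<tau> x))) has_vector_derivative
            \<tau>' s * - (inverse (\<tau> s) ^ Suc (Suc 0)) * ((\<phi> (inverse (\<tau> s)) - \<phi> 0) / inverse (\<tau> s))) (at s)"
          using S(4)[OF sS] nz by (simp add: o_def k)
        then have "(P has_vector_derivative \<phi> 0 * (\<tau>' s / \<tau> s) -
            \<tau>' s * - (inverse (\<tau> s) ^ Suc (Suc 0)) * ((\<phi> (inverse (\<tau> s)) - \<phi> 0) / inverse (\<tau> s))) (at s)"
          unfolding P_def
          by (intro has_vector_derivative_diff has_vector_derivative_mult_right logT_has_vector_derivative s01 \<tau>)
        moreover have "\<phi> 0 * (\<tau>' s / \<tau> s) -
            \<tau>' s * - (inverse (\<tau> s) ^ Suc (Suc 0)) * ((\<phi> (inverse (\<tau> s)) - \<phi> 0) / inverse (\<tau> s)) =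
            \<phi> (inverse (\<tau> s)) * \<tau>' s / \<tau> s"
          using nz by (simp add: field_simps)
        moreover have "E p q \<mu> (\<nu> - 1) z s = \<phi> (inverse (\<tau> s)) * \<tau>' s / \<tau> s"
          using H_shift[OF s01, of p q \<mu> \<nu> z] S(4)[OF sS] nz by (simp add: E_eq_H field_simps)
        ultimately show "(P has_vector_derivative E p q \<mu> (\<nu> - 1) z s) (at s)"
          by simp
      qed
      then show ?thesis
        unfolding J_def by (rule integral_unique)
    qed
    from E_primitive_converges[OF z(1) F S(1,2,3) this] obtain l where l: "(P \<longlongrightarrow> l) F"
      by blast
    have "isCont Q 0"
      using Q[of 0] \<rho> DERIV_isCont by auto
    then have "((\<lambda>s. Q (inverse (\<tau> s))) \<longlongrightarrow> Q 0) F"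
      using w by (rule isCont_tendsto_compose)
    with l have "((\<lambda>s. inverse (\<phi> 0) * (P s + Q (inverse (\<tau> s)))) \<longlongrightarrow> inverse (\<phi> 0) * (l + Q 0)) F"
      by (intro tendsto_intros)
    moreover have "\<phi> 0 \<noteq> 0"
      by (simp add: \<phi>_def)
    ultimately have "(logT \<longlongrightarrow> inverse (\<phi> 0) * (l + Q 0)) F"
      by (simp add: P_def mult.assoc[symmetric])
    then show False
      by (rule logT_diverges[OF F w])
  qed
qed

text \<open>The defect is continuous along each coordinate axis, so an arbitrarily small
  displacement keeps it nonzero while avoiding finitely many values of that coordinate. This
  provides points in general position.\<close>

lemma defect_move:
  assumes z: "z \<in> \<Omega>" and nz: "defect z \<noteq> 0" and X: "finite X"
  obtains t where "z + axis i t \<in> \<Omega>" "defect (z + axis i t) \<noteq> 0" "(z + axis i t) $ i \<notin> X"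
proof -
  have cont: "isCont (\<lambda>t. f (z + axis i t)) 0" if "has_pds_on f \<Omega>" for f
    using that z field_differentiable_imp_continuous_at unfolding has_pds_on_def by blast
  have comp: "isCont (\<lambda>t. (z + axis i t) $ j) 0" for j
    by (cases "j = i") (simp_all add: axis_component)
  have "isCont (\<lambda>t. defect (z + axis i t)) 0"
    unfolding defect_def N1_def
    by (intro continuous_intros cont comp Kint_has_pds pd_Kint_has_pds)
  then have "((\<lambda>t. defect (z + axis i t)) \<longlongrightarrow> defect z) (at 0)"
    by (simp add: continuous_at axis_zero)
  then have 1: "\<forall>\<^sub>F t in at 0. defect (z + axis i t) \<noteq> 0"
    using nz by (rule tendsto_imp_eventually_ne)
  have 2: "\<forall>\<^sub>F t in at 0. z + axis i t \<in> \<Omega>"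
    using eventually_add_axis_mem[OF open_\<Omega> z, of i] by (simp add: eventually_at_filter eventually_mono)
  have "\<forall>\<^sub>F t in at 0. \<forall>x\<in>X. t \<noteq> x - z $ i"
    by (intro eventually_ball_finite X ballI eventually_neq_at_within)
  with 1 2 have "\<forall>\<^sub>F t in at 0. z + axis i t \<in> \<Omega> \<and> defect (z + axis i t) \<noteq> 0 \<and> (z + axis i t) $ i \<notin> X"
    by eventually_elim (auto simp: axis_component)
  then show thesis
    using that eventually_happens'[OF at_neq_bot] by blast
qed

end

section \<open>Vanishing of the defect under the boundary condition\<close>

locale closed_contour = convergent_contour +
  assumes boundary: "\<And>z. z \<in> \<Omega> \<Longrightarrow>
      has_end_difference
        (\<lambda>s. branch_power logA (\<alpha> + \<nu>) (s, z) * branch_power logB (\<beta> + \<nu>) (s, z) *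
             branch_power logT (\<nu> - 1) s) 0"
    and degenerate: "\<alpha> + \<nu> = 0 \<Longrightarrow> \<beta> + \<nu> = 0 \<Longrightarrow> has_end_difference (branch_power logT \<nu>) 0"
begin

lemma boundary_limits:
  assumes z: "z \<in> \<Omega>"
  obtains h where "(H p q \<mu> (\<nu> - 1) z \<longlongrightarrow> h) (at_right 0)" "(H p q \<mu> (\<nu> - 1) z \<longlongrightarrow> h) (at_left 1)"
proof -
  let ?b = "\<lambda>s. branch_power logA (\<alpha> + \<nu>) (s, z) * branch_power logB (\<beta> + \<nu>) (s, z) * branch_power logT (\<nu> - 1) s"
  obtain h where h: "(?b \<longlongrightarrow> h) (at_right 0)" "(?b \<longlongrightarrow> h) (at_left 1)"
    using boundary[OF z] unfolding has_end_difference_def by auto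
  have eq: "H p q \<mu> (\<nu> - 1) z = (\<lambda>s. exp (\<mu> * logZ z) * ?b s)"
    by (simp add: H_def branch_power_def exp_add fun_eq_iff)
  show thesis
    by (rule that[of "exp (\<mu> * logZ z) * h"]; unfold eq; intro tendsto_intros h)
qed

lemma end_value:
  assumes z: "z \<in> \<Omega>" and F: "is_end F"
    and h: "(H p q \<mu> (\<nu> - 1) z \<longlongrightarrow> h) F" and g: "(H p q \<mu> \<nu> z \<longlongrightarrow> g) F" and t: "(\<tau> \<longlongrightarrow> t) F"
  shows "g = t * h"
proof -
  have "((\<lambda>s. \<tau> s * H p q \<mu> (\<nu> - 1) z s) \<longlongrightarrow> t * h) F"
    by (intro tendsto_intros h t)
  then have "(H p q \<mu> \<nu> z \<longlongrightarrow> t * h) F"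
    by (rule Lim_transform_eventually) (use is_end_inside[OF F] in eventually_elim, simp add: H_shift[symmetric])
  then show ?thesis
    using tendsto_unique[OF is_end_nontrivial[OF F] g] by blast
qed

text \<open>The contour variable is itself the quotient of the two functions whose limits are
  known.\<close>

lemma end_parameter:
  assumes z: "z \<in> \<Omega>" and F: "is_end F"
    and h: "(H p q \<mu> (\<nu> - 1) z \<longlongrightarrow> h) F" "h \<noteq> 0" and g: "(H p q \<mu> \<nu> z \<longlongrightarrow> g) F"
  shows "(\<tau> \<longlongrightarrow> g / h) F"
proof -
  have "((\<lambda>s. H p q \<mu> \<nu> z s / H p q \<mu> (\<nu> - 1) z s) \<longlongrightarrow> g / h) F"
    by (intro tendsto_intros h g)
  then show ?thesis
    by (rule Lim_transform_eventually)
      (use is_end_inside[OF F] in eventually_elim, simp add: H_shift[of _ _ _ _ \<nu>] H_nonzero)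
qed

text \<open>Rewriting the inverse as \<tau> / (\<tau> a + b) also covers \<open>t = 0\<close>, where
  1 / \<tau> has no finite limit.\<close>

lemma inverse_base_limit:
  fixes t :: complex
  assumes F: "is_end F" and t: "(\<tau> \<longlongrightarrow> t) F" and nz: "t * a + b \<noteq> 0"
  shows "((\<lambda>s. inverse (a + inverse (\<tau> s) * b)) \<longlongrightarrow> t / (t * a + b)) F"
proof -
  have "((\<lambda>s. \<tau> s / (\<tau> s * a + b)) \<longlongrightarrow> t / (t * a + b)) F"
    by (intro tendsto_intros t nz)
  then show ?thesis
  proof (rule Lim_transform_eventually)
    show "\<forall>\<^sub>F s in F. \<tau> s / (\<tau> s * a + b) = inverse (a + inverse (\<tau> s) * b)"
      using is_end_inside[OF F]
    proof eventually_elim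
      case (elim s)
      then have "\<tau> s \<noteq> 0"
        using exp_logs(4) by blast
      then have "\<tau> s * a + b = \<tau> s * (a + inverse (\<tau> s) * b)"
        by (simp add: algebra_simps)
      then show ?case
        using \<open>\<tau> s \<noteq> 0\<close> by (simp add: divide_inverse)
    qed
  qed
qed

text \<open>Along z_1 only A varies, and 1 / A tends to t / (t z_1 - z_{-2}) at an end with
  parameter t. Equality of these slopes at both ends amounts to (t0 - t1) z_{-2} = 0; the conditions
  on \<open>z\<close> keep the denominators and z_{-2} away from 0.\<close>

lemma finite_ends_eq_A:
  assumes z: "z \<in> \<Omega>" and pnz: "p \<noteq> 0"
    and h: "(H p q \<mu> (\<nu> - 1) z \<longlongrightarrow> h) (at_right 0)" "(H p q \<mu> (\<nu> - 1) z \<longlongrightarrow> h) (at_left 1)" "h \<noteq> 0"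
    and t: "(\<tau> \<longlongrightarrow> t0) (at_right 0)" "(\<tau> \<longlongrightarrow> t1) (at_left 1)"
    and gen: "z $ Zm2 \<noteq> 0" "t0 * z $ Zp1 \<noteq> z $ Zm2" "t1 * z $ Zp1 \<noteq> z $ Zm2"
  shows "t0 = t1"
proof -
  obtain r where r: "r > 0" "ball z r \<subseteq> \<Omega>"
    using open_\<Omega> z openE by blast
  have mem: "z + axis Zp1 u \<in> \<Omega>" if "u \<in> ball 0 r" for u
    using r(2) that by (auto simp: dist_norm norm_axis_complex subset_iff)
  have ends: "is_end (at_right 0)" "is_end (at_left 1)"
    by (auto simp: is_end_def)
  have "t0 / (t0 * z $ Zp1 + - z $ Zm2) = t1 / (t1 * z $ Zp1 + - z $ Zm2)"
  proof (rule end_slopes_eq[where F = "at_right 0" and F' = "at_left 1" and r = r and p = p and P = "\<lambda>s. 0 < s \<and> s < 1"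
        and \<Lambda> = "\<lambda>s u. logA (s, z + axis Zp1 u)" and A = "\<lambda>s. z $ Zp1 + inverse (\<tau> s) * - z $ Zm2"
        and h = "\<lambda>s u. H p q \<mu> (\<nu> - 1) (z + axis Zp1 u) s" and c = h])
    show "continuous_on (ball 0 r) (\<lambda>u. logA (s, z + axis Zp1 u))" if "0 < s \<and> s < 1" for s
      using that mem by (intro logs_along_axis) auto
    show "exp (logA (s, z + axis Zp1 u)) = z $ Zp1 + inverse (\<tau> s) * - z $ Zm2 + u"
      if "0 < s \<and> s < 1" "u \<in> ball 0 r" for s u
      using that mem by (simp add: exp_logs baseA_def axis_component)
    show "H p q \<mu> (\<nu> - 1) (z + axis Zp1 u) s = H p q \<mu> (\<nu> - 1) (z + axis Zp1 0) s *
        exp (p * (logA (s, z + axis Zp1 u) - logA (s, z + axis Zp1 0)))" if "0 < s \<and> s < 1" "u \<in> ball 0 r" for s u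
      unfolding H_def exp_add[symmetric]
      using that logs_along_axis(5,6)[of s r z Zp1 u] mem by (simp add: axis_zero algebra_simps)
    show "\<exists>l. ((\<lambda>s. H p q \<mu> (\<nu> - 1) (z + axis Zp1 u) s) \<longlongrightarrow> l) (at_right 0) \<and>
        ((\<lambda>s. H p q \<mu> (\<nu> - 1) (z + axis Zp1 u) s) \<longlongrightarrow> l) (at_left 1)" if "u \<in> ball 0 r" for u
      using boundary_limits[OF mem[OF that]] by blast
    show "((\<lambda>s. inverse (z $ Zp1 + inverse (\<tau> s) * - z $ Zm2)) \<longlongrightarrow> t0 / (t0 * z $ Zp1 + - z $ Zm2)) (at_right 0)"
      by (rule inverse_base_limit[OF ends(1) t(1)]) (use gen in auto)
    show "((\<lambda>s. inverse (z $ Zp1 + inverse (\<tau> s) * - z $ Zm2)) \<longlongrightarrow> t1 / (t1 * z $ Zp1 + - z $ Zm2)) (at_left 1)"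
      by (rule inverse_base_limit[OF ends(2) t(2)]) (use gen in auto)
  qed (use r pnz h ends is_end_nontrivial is_end_inside in \<open>auto simp: axis_zero\<close>)
  then have "(t0 - t1) * z $ Zm2 = 0"
    using gen by (simp add: field_simps)
  then show ?thesis
    using gen by simp
qed

text \<open>The same argument along z_2, where only B varies; it leads to (t0 - t1) z_{-1} =
  0.\<close>

lemma finite_ends_eq_B:
  assumes z: "z \<in> \<Omega>" and qnz: "q \<noteq> 0"
    and h: "(H p q \<mu> (\<nu> - 1) z \<longlongrightarrow> h) (at_right 0)" "(H p q \<mu> (\<nu> - 1) z \<longlongrightarrow> h) (at_left 1)" "h \<noteq> 0"
    and t: "(\<tau> \<longlongrightarrow> t0) (at_right 0)" "(\<tau> \<longlongrightarrow> t1) (at_left 1)"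
    and gen: "z $ Zm1 \<noteq> 0" "t0 * z $ Zp2 + z $ Zm1 \<noteq> 0" "t1 * z $ Zp2 + z $ Zm1 \<noteq> 0"
  shows "t0 = t1"
proof -
  obtain r where r: "r > 0" "ball z r \<subseteq> \<Omega>"
    using open_\<Omega> z openE by blast
  have mem: "z + axis Zp2 u \<in> \<Omega>" if "u \<in> ball 0 r" for u
    using r(2) that by (auto simp: dist_norm norm_axis_complex subset_iff)
  have ends: "is_end (at_right 0)" "is_end (at_left 1)"
    by (auto simp: is_end_def)
  have "t0 / (t0 * z $ Zp2 + z $ Zm1) = t1 / (t1 * z $ Zp2 + z $ Zm1)"
  proof (rule end_slopes_eq[where F = "at_right 0" and F' = "at_left 1" and r = r and p = q and P = "\<lambda>s. 0 < s \<and> s < 1"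
        and \<Lambda> = "\<lambda>s u. logB (s, z + axis Zp2 u)" and A = "\<lambda>s. z $ Zp2 + inverse (\<tau> s) * z $ Zm1"
        and h = "\<lambda>s u. H p q \<mu> (\<nu> - 1) (z + axis Zp2 u) s" and c = h])
    show "continuous_on (ball 0 r) (\<lambda>u. logB (s, z + axis Zp2 u))" if "0 < s \<and> s < 1" for s
      using that mem by (intro logs_along_axis) auto
    show "exp (logB (s, z + axis Zp2 u)) = z $ Zp2 + inverse (\<tau> s) * z $ Zm1 + u"
      if "0 < s \<and> s < 1" "u \<in> ball 0 r" for s u
      using that mem by (simp add: exp_logs baseB_def axis_component)
    show "H p q \<mu> (\<nu> - 1) (z + axis Zp2 u) s = H p q \<mu> (\<nu> - 1) (z + axis Zp2 0) s *
        exp (q * (logB (s, z + axis Zp2 u) - logB (s, z + axis Zp2 0)))" if "0 < s \<and> s < 1" "u \<in> ball 0 r" for s u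
      unfolding H_def exp_add[symmetric]
      using that logs_along_axis(4,6)[of s r z Zp2 u] mem by (simp add: axis_zero algebra_simps)
    show "\<exists>l. ((\<lambda>s. H p q \<mu> (\<nu> - 1) (z + axis Zp2 u) s) \<longlongrightarrow> l) (at_right 0) \<and>
        ((\<lambda>s. H p q \<mu> (\<nu> - 1) (z + axis Zp2 u) s) \<longlongrightarrow> l) (at_left 1)" if "u \<in> ball 0 r" for u
      using boundary_limits[OF mem[OF that]] by blast
    show "((\<lambda>s. inverse (z $ Zp2 + inverse (\<tau> s) * z $ Zm1)) \<longlongrightarrow> t0 / (t0 * z $ Zp2 + z $ Zm1)) (at_right 0)"
      by (rule inverse_base_limit[OF ends(1) t(1) gen(2)])
    show "((\<lambda>s. inverse (z $ Zp2 + inverse (\<tau> s) * z $ Zm1)) \<longlongrightarrow> t1 / (t1 * z $ Zp2 + z $ Zm1)) (at_left 1)"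
      by (rule inverse_base_limit[OF ends(2) t(2) gen(3)])
  qed (use r qnz h ends is_end_nontrivial is_end_inside in \<open>auto simp: axis_zero\<close>)
  then have "(t0 - t1) * z $ Zm1 = 0"
    using gen by (simp add: field_simps)
  then show ?thesis
    using gen by simp
qed

text \<open>A and B drop out, so \<open>H\<close> at exponent \<nu> is z_3^\<mu> \<tau>^\<nu> and
  the condition on \<tau>^\<nu> makes its end values equal.\<close>

lemma defect_zero_degenerate:
  assumes z: "z \<in> \<Omega>" and "p = 0" "q = 0"
  shows "defect z = 0"
proof -
  obtain h where h: "(branch_power logT \<nu> \<longlongrightarrow> h) (at_right 0)" "(branch_power logT \<nu> \<longlongrightarrow> h) (at_left 1)"
    using degenerate assms(2,3) unfolding has_end_difference_def by auto
  have eq: "H p q \<mu> \<nu> z = (\<lambda>s. exp (\<mu> * logZ z) * branch_power logT \<nu> s)"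
    unfolding assms(2,3) by (simp add: H_def branch_power_def exp_add fun_eq_iff)
  have "(H p q \<mu> \<nu> z \<longlongrightarrow> exp (\<mu> * logZ z) * h) (at_right 0)" "(H p q \<mu> \<nu> z \<longlongrightarrow> exp (\<mu> * logZ z) * h) (at_left 1)"
    unfolding eq by (intro tendsto_intros h)+
  moreover obtain g0 g1 where "(H p q \<mu> \<nu> z \<longlongrightarrow> g0) (at_right 0)" "(H p q \<mu> \<nu> z \<longlongrightarrow> g1) (at_left 1)"
    "g1 - g0 = inverse inv_2pi_i * defect z"
    by (rule H_end_limits[OF z])
  ultimately have "inverse inv_2pi_i * defect z = 0"
    using tendsto_unique[OF trivial_limit_at_right_real] tendsto_unique[OF trivial_limit_at_left_real]
    by (metis diff_self)
  then show ?thesis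
    using inv_2pi_i_nonzero by simp
qed

lemma defect_zero:
  assumes z: "z \<in> \<Omega>"
  shows "defect z = 0"
proof (rule ccontr)
  assume nz: "defect z \<noteq> 0"
  then have pq: "p \<noteq> 0 \<or> q \<noteq> 0"
    using defect_zero_degenerate[OF z] by blast
  have ends: "is_end (at_right 0)" "is_end (at_left 1)"
    by (auto simp: is_end_def)
  \<comment> \<open>Nonzero z_1 and z_2 will be required to exclude an end at infinity; two
    displacements achieve this without losing the nonzero defect.\<close>
  obtain a where a: "z + axis Zp1 a \<in> \<Omega>" "defect (z + axis Zp1 a) \<noteq> 0" "(z + axis Zp1 a) $ Zp1 \<notin> {0}"
    by (rule defect_move[OF z nz, of "{0}"]) auto
  obtain b where b: "z + axis Zp1 a + axis Zp2 b \<in> \<Omega>" "defect (z + axis Zp1 a + axis Zp2 b) \<noteq> 0"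
      "(z + axis Zp1 a + axis Zp2 b) $ Zp2 \<notin> {0}"
    by (rule defect_move[OF a(1,2), of "{0}"]) auto
  define v where "v = z + axis Zp1 a + axis Zp2 b"
  have v: "v \<in> \<Omega>" "defect v \<noteq> 0" "v $ Zp1 \<noteq> 0" "v $ Zp2 \<noteq> 0"
    using a b by (auto simp: v_def axis_component)
  obtain g0 g1 where g: "(H p q \<mu> \<nu> v \<longlongrightarrow> g0) (at_right 0)" "(H p q \<mu> \<nu> v \<longlongrightarrow> g1) (at_left 1)"
      "g1 - g0 = inverse inv_2pi_i * defect v"
    by (rule H_end_limits[OF v(1)])
  obtain h where h: "(H p q \<mu> (\<nu> - 1) v \<longlongrightarrow> h) (at_right 0)" "(H p q \<mu> (\<nu> - 1) v \<longlongrightarrow> h) (at_left 1)"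
    by (rule boundary_limits[OF v(1)])
  have gne: "g0 \<noteq> g1"
    using g(3) v(2) inv_2pi_i_nonzero by auto
  \<comment> \<open>If the boundary value vanished, a nonzero \<open>g0\<close> or \<open>g1\<close>
    would belong to an end at infinity, so both would be 0 and hence equal.\<close>
  have "h \<noteq> 0"
  proof
    assume "h = 0"
    then have "g0 = 0" "g1 = 0"
      using not_infinite_end[OF v(1,3,4)] ends g(1,2) h by blast+
    with gne show False
      by simp
  qed
  define t0 t1 where "t0 = g0 / h" and "t1 = g1 / h"
  have t: "(\<tau> \<longlongrightarrow> t0) (at_right 0)" "(\<tau> \<longlongrightarrow> t1) (at_left 1)"
    unfolding t0_def t1_def
    by (rule end_parameter[OF v(1) ends(1) h(1) \<open>h \<noteq> 0\<close> g(1)] end_parameter[OF v(1) ends(2) h(2) \<open>h \<noteq> 0\<close> g(2)])+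
  have tne: "t0 \<noteq> t1"
    using gne \<open>h \<noteq> 0\<close> by (simp add: t0_def t1_def)
  \<comment> \<open>\<open>t0\<close> and \<open>t1\<close> belong to the contour and not to the
    point \<open>v\<close>. At any other \<open>u\<close> the end values of \<open>H\<close> are
    \<open>t0 * h\<close> and \<open>t1 * h\<close>, so a nonzero defect still forces a nonzero
    boundary value.\<close>
  have bv: "\<exists>h. (H p q \<mu> (\<nu> - 1) u \<longlongrightarrow> h) (at_right 0) \<and> (H p q \<mu> (\<nu> - 1) u \<longlongrightarrow> h) (at_left 1) \<and> h \<noteq> 0"
    if u: "u \<in> \<Omega>" "defect u \<noteq> 0" for u
  proof -
    obtain k0 k1 where k: "(H p q \<mu> \<nu> u \<longlongrightarrow> k0) (at_right 0)" "(H p q \<mu> \<nu> u \<longlongrightarrow> k1) (at_left 1)"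
        "k1 - k0 = inverse inv_2pi_i * defect u"
      by (rule H_end_limits[OF u(1)])
    obtain h where h: "(H p q \<mu> (\<nu> - 1) u \<longlongrightarrow> h) (at_right 0)" "(H p q \<mu> (\<nu> - 1) u \<longlongrightarrow> h) (at_left 1)"
      by (rule boundary_limits[OF u(1)])
    have "k0 = t0 * h" "k1 = t1 * h"
      by (rule end_value[OF u(1) ends(1) h(1) k(1) t(1)] end_value[OF u(1) ends(2) h(2) k(2) t(2)])+
    then have "h \<noteq> 0"
      using k(3) u(2) inv_2pi_i_nonzero by auto
    with h show ?thesis
      by blast
  qed
  from pq show False
  proof
    assume "p \<noteq> 0"
    \<comment> \<open>Displacing z_{-2} leaves z_1 unchanged, so the values to be avoided, namely 0
      and the zeros of the two denominators, are fixed beforehand.\<close>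
    obtain c where c: "v + axis Zm2 c \<in> \<Omega>" "defect (v + axis Zm2 c) \<noteq> 0"
        "(v + axis Zm2 c) $ Zm2 \<notin> {0, t0 * v $ Zp1, t1 * v $ Zp1}"
      by (rule defect_move[OF v(1,2), of "{0, t0 * v $ Zp1, t1 * v $ Zp1}"]) auto
    obtain k where k: "(H p q \<mu> (\<nu> - 1) (v + axis Zm2 c) \<longlongrightarrow> k) (at_right 0)"
        "(H p q \<mu> (\<nu> - 1) (v + axis Zm2 c) \<longlongrightarrow> k) (at_left 1)" "k \<noteq> 0"
      using bv[OF c(1,2)] by blast
    have "t0 = t1"
      by (rule finite_ends_eq_A[OF c(1) \<open>p \<noteq> 0\<close> k t]) (use c(3) in \<open>auto simp: axis_component\<close>)
    with tne show False
      by contradiction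
  next
    assume "q \<noteq> 0"
    obtain c where c: "v + axis Zm1 c \<in> \<Omega>" "defect (v + axis Zm1 c) \<noteq> 0"
        "(v + axis Zm1 c) $ Zm1 \<notin> {0, - (t0 * v $ Zp2), - (t1 * v $ Zp2)}"
      by (rule defect_move[OF v(1,2), of "{0, - (t0 * v $ Zp2), - (t1 * v $ Zp2)}"]) auto
    obtain k where k: "(H p q \<mu> (\<nu> - 1) (v + axis Zm1 c) \<longlongrightarrow> k) (at_right 0)"
        "(H p q \<mu> (\<nu> - 1) (v + axis Zm1 c) \<longlongrightarrow> k) (at_left 1)" "k \<noteq> 0"
      using bv[OF c(1,2)] by blast
    have "t0 = t1"
      by (rule finite_ends_eq_B[OF c(1) \<open>q \<noteq> 0\<close> k t])
        (use c(3) in \<open>auto simp: axis_component add_eq_0_iff\<close>)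
    with tne show False
      by contradiction
  qed
qed

end

theorem proposition5p2:
  fixes \<alpha> \<beta> \<mu> \<nu> :: complex
    and \<Omega> :: "(complex ^ coord) set"
    and \<tau> :: "real \<Rightarrow> complex"
    and logA logB :: "real \<times> (complex ^ coord) \<Rightarrow> complex"
    and logT :: "real \<Rightarrow> complex"
    and logZ :: "complex ^ coord \<Rightarrow> complex"
  assumes "open \<Omega>"
    and "open_contour \<tau>"
    and "log_branch ({0<..<1} \<times> \<Omega>) (\<lambda>(s, z). z $ Zp1 - inverse (\<tau> s) * z $ Zm2) logA"
    and "log_branch ({0<..<1} \<times> \<Omega>) (\<lambda>(s, z). z $ Zp2 + inverse (\<tau> s) * z $ Zm1) logB"
    and "log_branch {0<..<1} \<tau> logT"
    and "log_branch \<Omega> (\<lambda>z. z $ Zp3) logZ"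
    and "converges_locally_uniformly_on (integrand logA logB logT logZ \<tau> \<alpha> \<beta> \<mu> \<nu>) \<Omega>"
    and "\<And>z. z \<in> \<Omega> \<Longrightarrow>
      has_end_difference
        (\<lambda>s. branch_power logA (\<alpha> + \<nu>) (s, z) * branch_power logB (\<beta> + \<nu>) (s, z) *
             branch_power logT (\<nu> - 1) s) 0"
    and degenerate: "\<alpha> + \<nu> = 0 \<Longrightarrow> \<beta> + \<nu> = 0 \<Longrightarrow> has_end_difference (branch_power logT \<nu>) 0"
  shows "has_pds_on (K logA logB logT logZ \<tau> \<alpha> \<beta> \<mu> \<nu>) \<Omega>
    \<and> (\<forall>i. has_pds_on (pd i (K logA logB logT logZ \<tau> \<alpha> \<beta> \<mu> \<nu>)) \<Omega>)
    \<and> (\<forall>z\<in>\<Omega>.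
          laplacian (K logA logB logT logZ \<tau> \<alpha> \<beta> \<mu> \<nu>) z = 0
        \<and> N1 (K logA logB logT logZ \<tau> \<alpha> \<beta> \<mu> \<nu>) z = \<alpha> * K logA logB logT logZ \<tau> \<alpha> \<beta> \<mu> \<nu> z
        \<and> N2 (K logA logB logT logZ \<tau> \<alpha> \<beta> \<mu> \<nu>) z = \<beta> * K logA logB logT logZ \<tau> \<alpha> \<beta> \<mu> \<nu> z
        \<and> N3 (K logA logB logT logZ \<tau> \<alpha> \<beta> \<mu> \<nu>) z = \<mu> * K logA logB logT logZ \<tau> \<alpha> \<beta> \<mu> \<nu> z)"
proof -
  interpret closed_contour \<Omega> \<tau> logA logB logT logZ \<alpha> \<beta> \<mu> \<nu>
    by unfold_locales (use assms in blast)+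
  show ?thesis
    using Kint_has_pds pd_Kint_has_pds Kint_harmonic defect_zero defect_limit(2,3)
    by (auto simp: defect_def)
qed

end
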